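(* Let $2\le n\in\omega$ and let $\mathcal{F}$ be an $n$-capturing construction scheme with $\mathfrak{m}^n_{\mathcal{F}}>\omega_1$. Then $\mathcal{U}_n(\mathcal{F})$ is a Ramsey ultrafilter on $\omega$.
   Context: Types: $\tau=\langle m_k,n_{k+1},r_{k+1}\rangle_{k\in\omega}$ with $m_0=1$, $n_{k+1}\ge2$, $m_k>r_{k+1}$, $m_{k+1}=r_{k+1}+(m_k-r_{k+1})n_{k+1}$, assumed good (each $r$ equals $r_k$ for infinitely many $k$). A construction scheme of type $\tau$ is a family $\mathcal{F}$ of nonempty finite subsets of $\omega_1$, cofinal under $\subseteq$, each of size some $m_k$, such that with $\mathcal{F}_k=\{F\in\mathcal{F}:|F|=m_k\}$: (i) for $E,F\in\mathcal{F}_k$, $E\cap F$ is an initial segment of both; (ii) each $F\in\mathcal{F}_{k+1}$ is $F_0\cup\dots\cup F_{n_{k+1}-1}$ with $F_i\in\mathcal{F}_k$ a $\Delta$-system with root $R(F)$, $|R(F)|=r_{k+1}$, $R(F)<F_0\setminus R(F)<\dots<F_{n_{k+1}-1}\setminus R(F)$. Let $\rho(\alpha,\beta)=\min\{k:\exists F\in\mathcal{F}_k\ \{\alpha,\beta\}\subseteq F\}$ and for finite $A$, $\rho^A=\max\{\rho(\alpha,\beta):\alpha,\beta\in A\}$; $\|\alpha\|_k=|\{\xi<\alpha:\rho(\alpha,\xi)\le k\}|$, $\Delta(\alpha,\beta)=\min\{k:\|\alpha\|_k\ne\|\beta\|_k\}$. $\Xi_\alpha(0)=0$; for $k\ge1$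 and $F\in\mathcal{F}_k$ containing $\alpha$, $\Xi_\alpha(k)=-1$ if $\alpha\in R(F)$, $=i$ if $\alpha\in F_i\setminus R(F)$. $D(a)$ is the $a$-th element of a finite set $D$ of ordinals. A family $\langle D_i\rangle_{i<n}$ of subsets of $\omega_1$ each of size $m$ forming a root-tail-tail $\Delta$-system (pairwise intersections equal a root $R$, $|R|=r$, $R<D_i\setminus R$, $D_0\setminus R<D_1\setminus R<\dots$) is captured at level $l$ if $\Xi_{D_i(a)}(l)=-1$ for $a<r$, $=i$ for $r\le a<m$, and $\rho(D_i(a),D_j(a))=l=\Delta(D_i(a),D_j(a))$ for $i<j<n$, $r\le a<m$; a finite set $D\subseteq\omega_1$ is captured (at level $l$) if $\{\{\alpha\}:\alpha\in D\}$ is. $\mathcal{F}$ is $n$-capturing if for every uncountable family $\mathcal{S}$ of finite subsets of $\omega_1$ there are infinitely many $l$ such that some $n$ members of $\mathcal{S}$ form a family captured at level $l$. $\mathfrak{m}(\mathbb{P})$ is the least $\kappa$ such that some $\kappa$ dense subsets of $\mathbb{P}$ are not all met by one filter; $\mathfrak{m}^n_{\mathcal{F}}=\min\{\mathfrak{m}(\mathbb{P}):\mathbb{P}\text{ ccc},\ \mathbb{P}\Vdash\mathcal{F}\text{ is }n\text{-capturing}\}$ when $\mathcal{F}$ is $n$-capturing. For $S\subseteq\omega_1$, $\pi_n(S)=\{\rho^D: D\in[S]^n,\ D\text{ captured}\}$, and $\mathcal{U}_n(\mathcal{F})=\{A\subseteq\omega:\exists S\in[\omega_1]^{\omega_1}\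 \pi_n(S)\subseteq A\}$. An ultrafilter $\mathcal{U}$ on $\omega$ is Ramsey if for every infinite partition of $\omega$ into sets not in $\mathcal{U}$ there is $A\in\mathcal{U}$ meeting each piece in at most one point. *)

theory Defs
  imports "HOL-Library.Countable_Set_Type" "HOL-Library.Disjoint_Sets"
begin

unbundle cardinal_syntax

section \<open>The ordinal \<open>\<omega>\<^sub>1\<close>\<close>

typedef omega1 = "Field (cardSuc natLeq)"
proof -
  have "Field (cardSuc natLeq) \<noteq> {}"
    using Field_cardSuc_not_empty natLeq_Card_order by blast
  then show ?thesis by blast
qed

instantiation omega1 :: wellorder
begin

definition less_eq_omega1 :: "omega1 \<Rightarrow> omega1 \<Rightarrow> bool"
  where "x \<le> y \<longleftrightarrow> (Rep_omega1 x, Rep_omega1 y) \<in> cardSuc natLeq"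

definition less_omega1 :: "omega1 \<Rightarrow> omega1 \<Rightarrow> bool"
  where "x < y \<longleftrightarrow> (Rep_omega1 x, Rep_omega1 y) \<in> cardSuc natLeq - Id"

instance
proof -
  have wo: "well_order_on (Field (cardSuc natLeq)) (cardSuc natLeq)"
    using cardSuc_Well_order natLeq_Card_order by blast
  then have lin: "Linear_order (cardSuc natLeq)" and wf: "wf (cardSuc natLeq - Id)"
    by (auto simp: well_order_on_def)
  have refl: "refl_on (Field (cardSuc natLeq)) (cardSuc natLeq)"
    and trans: "trans (cardSuc natLeq)" and antisym: "antisym (cardSuc natLeq)"
    and total: "total_on (Field (cardSuc natLeq)) (cardSuc natLeq)"
    using lin by (auto simp: order_on_defs)
  show "OFCLASS(omega1, wellorder_class)"
  proof
    fix x y z :: omega1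
    show "x < y \<longleftrightarrow> x \<le> y \<and> \<not> y \<le> x"
      unfolding less_eq_omega1_def less_omega1_def
      using antisymD[OF antisym] refl_onD[OF refl Rep_omega1] by auto
    show "x \<le> x"
      unfolding less_eq_omega1_def using refl_onD[OF refl Rep_omega1] .
    show "x \<le> y \<Longrightarrow> y \<le> z \<Longrightarrow> x \<le> z"
      unfolding less_eq_omega1_def using transD[OF trans] by blast
    show "x \<le> y \<Longrightarrow> y \<le> x \<Longrightarrow> x = y"
      unfolding less_eq_omega1_def using antisymD[OF antisym] Rep_omega1_inject by blast
    show "x \<le> y \<or> y \<le> x"
      unfolding less_eq_omega1_def using total refl_onD[OF refl Rep_omega1]
      by (metis Rep_omega1 total_on_def)
  next
    fix P :: "omega1 \<Rightarrow> bool" and a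
    assume step: "\<And>x. (\<And>y. y < x \<Longrightarrow> P y) \<Longrightarrow> P x"
    have "wf {(x, y :: omega1). x < y}"
      using wf_inv_image[OF wf, of Rep_omega1]
      by (simp add: inv_image_def less_omega1_def)
    then show "P a"
      by (induction a rule: wf_induct_rule) (use step in auto)
  qed
qed

end

lemma card_of_omega1: "|UNIV :: omega1 set| =o cardSuc natLeq"
proof -
  have "bij_betw Rep_omega1 UNIV (Field (cardSuc natLeq))"
    by (metis Rep_omega1_inject bij_betw_def injI type_definition.Rep_range
        type_definition_omega1)
  then have "|UNIV :: omega1 set| =o |Field (cardSuc natLeq)|"
    using card_of_ordIsoI by blast
  also have "|Field (cardSuc natLeq)| =o cardSuc natLeq"
    by (simp add: card_of_Field_ordIso cardSuc_Card_order natLeq_Card_order)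
  finally show ?thesis .
qed

lemma uncountable_omega1: "uncountable (UNIV :: omega1 set)"
  by (metis card_of_omega1 cardSuc_greater countable_card_le_natLeq natLeq_Card_order
      not_ordLess_ordLeq ordIso_iff_ordLeq ordLess_ordLeq_trans)

lemma countable_lessThan_omega1: "countable {..<\<alpha> :: omega1}"
proof -
  let ?s = "cardSuc natLeq" and ?a = "Rep_omega1 \<alpha>"
  have "|underS ?s ?a| <o ?s"
    by (rule card_of_underS[OF cardSuc_Card_order[OF natLeq_Card_order] Rep_omega1])
  then have "countable (underS ?s ?a)"
    by (metis cardSuc_ordLess_ordLeq card_of_Card_order cardSuc_ordLeq_ordLess
        countable_card_le_natLeq natLeq_Card_order)
  moreover have "Rep_omega1 ` {..<\<alpha>} \<subseteq> underS ?s ?a"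
    by (auto simp: underS_def less_omega1_def)
  ultimately show ?thesis
    by (meson Rep_omega1_inject countable_image_inj_on countable_subset inj_onI)
qed


section \<open>Construction schemes\<close>

definition set_less :: "'a::order set \<Rightarrow> 'a set \<Rightarrow> bool"
  where "set_less A B \<longleftrightarrow> (\<forall>a\<in>A. \<forall>b\<in>B. a < b)"

definition initial_segment :: "'a::order set \<Rightarrow> 'a set \<Rightarrow> bool"
  where "initial_segment A B \<longleftrightarrow> A \<subseteq> B \<and> (\<forall>a\<in>A. \<forall>b\<in>B. b < a \<longrightarrow> b \<in> A)"

text \<open>The values \<open>nn \<tau> 0\<close> and \<open>rr \<tau> 0\<close> are junk: the sequences \<open>n\<close> and \<open>r\<close> start at index \<open>1\<close>.\<close>

record scheme_type =
  mm :: "nat \<Rightarrow> nat"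
  nn :: "nat \<Rightarrow> nat"
  rr :: "nat \<Rightarrow> nat"

definition good_type :: "scheme_type \<Rightarrow> bool"
  where "good_type \<tau> \<longleftrightarrow>
    mm \<tau> 0 = 1 \<and>
    (\<forall>k. nn \<tau> (Suc k) \<ge> 2 \<and> mm \<tau> k > rr \<tau> (Suc k) \<and>
         mm \<tau> (Suc k) = rr \<tau> (Suc k) + (mm \<tau> k - rr \<tau> (Suc k)) * nn \<tau> (Suc k)) \<and>
    (\<forall>s. infinite {k. k \<ge> 1 \<and> rr \<tau> k = s})"

definition root_tail_tail :: "nat \<Rightarrow> (nat \<Rightarrow> 'a::order set) \<Rightarrow> 'a set \<Rightarrow> bool"
  where "root_tail_tail n D R \<longleftrightarrow>
    (\<forall>i<n. R \<subseteq> D i \<and> set_less R (D i - R)) \<and>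
    (\<forall>i<n. \<forall>j<n. i \<noteq> j \<longrightarrow> D i \<inter> D j = R) \<and>
    (\<forall>i<n. \<forall>j<n. i < j \<longrightarrow> set_less (D i - R) (D j - R))"

definition level :: "scheme_type \<Rightarrow> omega1 set set \<Rightarrow> nat \<Rightarrow> omega1 set set"
  where "level \<tau> \<F> k = {F \<in> \<F>. card F = mm \<tau> k}"

text \<open>\<open>G\<close> and \<open>R\<close> are the pieces \<open>F\<^sub>0, F\<^sub>1, \<dots>\<close> and the root \<open>R(F)\<close> of \<open>F \<in> \<F>\<^sub>k\<close>, for \<open>k \<ge> 1\<close>.\<close>

definition decomposition ::
  "scheme_type \<Rightarrow> omega1 set set \<Rightarrow> nat \<Rightarrow> omega1 set \<Rightarrow> (nat \<Rightarrow> omega1 set) \<Rightarrow> omega1 set \<Rightarrow> bool"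
  where "decomposition \<tau> \<F> k F G R \<longleftrightarrow>
    F = (\<Union>i<nn \<tau> k. G i) \<and>
    (\<forall>i<nn \<tau> k. G i \<in> level \<tau> \<F> (k - 1)) \<and>
    root_tail_tail (nn \<tau> k) G R \<and> card R = rr \<tau> k"

definition construction_scheme :: "scheme_type \<Rightarrow> omega1 set set \<Rightarrow> bool"
  where "construction_scheme \<tau> \<F> \<longleftrightarrow>
    (\<forall>F\<in>\<F>. finite F \<and> F \<noteq> {} \<and> (\<exists>k. card F = mm \<tau> k)) \<and>
    (\<forall>A. finite A \<longrightarrow> (\<exists>F\<in>\<F>. A \<subseteq> F)) \<and>
    (\<forall>k. \<forall>E\<in>level \<tau> \<F> k. \<forall>F\<in>level \<tau> \<F> k.
        initial_segment (E \<inter> F) E \<and> initial_segment (E \<inter> F) F) \<and>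
    (\<forall>k. \<forall>F\<in>level \<tau> \<F> (Suc k). \<exists>G R. decomposition \<tau> \<F> (Suc k) F G R)"

definition rho :: "scheme_type \<Rightarrow> omega1 set set \<Rightarrow> omega1 \<Rightarrow> omega1 \<Rightarrow> nat"
  where "rho \<tau> \<F> \<alpha> \<beta> = (LEAST k. \<exists>F\<in>level \<tau> \<F> k. {\<alpha>, \<beta>} \<subseteq> F)"

definition rho_set :: "scheme_type \<Rightarrow> omega1 set set \<Rightarrow> omega1 set \<Rightarrow> nat"
  where "rho_set \<tau> \<F> A = Max {rho \<tau> \<F> \<alpha> \<beta> |\<alpha> \<beta>. \<alpha> \<in> A \<and> \<beta> \<in> A}"

definition norm_at :: "scheme_type \<Rightarrow> omega1 set set \<Rightarrow> omega1 \<Rightarrow> nat \<Rightarrow> nat"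
  where "norm_at \<tau> \<F> \<alpha> k = card {\<xi>. \<xi> < \<alpha> \<and> rho \<tau> \<F> \<alpha> \<xi> \<le> k}"

definition Delta :: "scheme_type \<Rightarrow> omega1 set set \<Rightarrow> omega1 \<Rightarrow> omega1 \<Rightarrow> nat"
  where "Delta \<tau> \<F> \<alpha> \<beta> = (LEAST k. norm_at \<tau> \<F> \<alpha> k \<noteq> norm_at \<tau> \<F> \<beta> k)"

text \<open>In a construction scheme every \<open>\<alpha>\<close> lies in some \<open>F \<in> \<F>\<^sub>k\<close>, and the value below depends
  neither on the choice of \<open>F\<close> nor on that of its decomposition.\<close>

definition Xi :: "scheme_type \<Rightarrow> omega1 set set \<Rightarrow> omega1 \<Rightarrow> nat \<Rightarrow> int"
  where "Xi \<tau> \<F> \<alpha> k =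
    (if k = 0 then 0
     else THE x. \<exists>F\<in>level \<tau> \<F> k. \<exists>G R. \<alpha> \<in> F \<and> decomposition \<tau> \<F> k F G R \<and>
            (\<alpha> \<in> R \<and> x = -1 \<or> (\<exists>i<nn \<tau> k. \<alpha> \<in> G i - R \<and> x = int i)))"


section \<open>Capturing\<close>

definition elt :: "omega1 set \<Rightarrow> nat \<Rightarrow> omega1"
  where "elt D a = sorted_list_of_set D ! a"

definition captured_family ::
  "scheme_type \<Rightarrow> omega1 set set \<Rightarrow> nat \<Rightarrow> nat \<Rightarrow> (nat \<Rightarrow> omega1 set) \<Rightarrow> bool"
  where "captured_family \<tau> \<F> l n D \<longleftrightarrow>
    (\<exists>m R. (\<forall>i<n. finite (D i) \<and> card (D i) = m) \<and> root_tail_tail n D R \<and>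
      (\<forall>i<n. \<forall>a<m. Xi \<tau> \<F> (elt (D i) a) l = (if a < card R then -1 else int i)) \<and>
      (\<forall>j<n. \<forall>i<j. \<forall>a. card R \<le> a \<and> a < m \<longrightarrow>
          rho \<tau> \<F> (elt (D i) a) (elt (D j) a) = l \<and>
          Delta \<tau> \<F> (elt (D i) a) (elt (D j) a) = l))"

text \<open>A finite set is captured when its singletons, enumerated increasingly, form a captured
  family; the condition on tails permits no other enumeration.\<close>

definition captured_set :: "scheme_type \<Rightarrow> omega1 set set \<Rightarrow> nat \<Rightarrow> omega1 set \<Rightarrow> bool"
  where "captured_set \<tau> \<F> l D \<longleftrightarrow>
    finite D \<and> captured_family \<tau> \<F> l (card D) (\<lambda>i. {elt D i})"

definition n_capturing :: "scheme_type \<Rightarrow> omega1 set set \<Rightarrow> nat \<Rightarrow> bool"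
  where "n_capturing \<tau> \<F> n \<longleftrightarrow>
    (\<forall>S. (\<forall>D\<in>S. finite D) \<and> uncountable S \<longrightarrow>
      infinite {l. \<exists>D. inj_on D {..<n} \<and> D ` {..<n} \<subseteq> S \<and> captured_family \<tau> \<F> l n D})"


section \<open>Posets and forcing\<close>

text \<open>A poset is a relation \<open>P\<close> with \<open>Partial_order P\<close>, carrier \<open>Field P \<noteq> {}\<close>, and \<open>(q, p) \<in> P\<close>
  meaning \<open>q \<le> p\<close> (\<open>q\<close> is stronger).\<close>

definition poset :: "'p rel \<Rightarrow> bool"
  where "poset P \<longleftrightarrow> Partial_order P \<and> Field P \<noteq> {}"

definition compatible :: "'p rel \<Rightarrow> 'p \<Rightarrow> 'p \<Rightarrow> bool"
  where "compatible P p q \<longleftrightarrow> (\<exists>s. (s, p) \<in> P \<and> (s, q) \<in> P)"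

definition ccc :: "'p rel \<Rightarrow> bool"
  where "ccc P \<longleftrightarrow>
    (\<forall>A\<subseteq>Field P. (\<forall>p\<in>A. \<forall>q\<in>A. p \<noteq> q \<longrightarrow> \<not> compatible P p q) \<longrightarrow> countable A)"

definition dense_in :: "'p rel \<Rightarrow> 'p set \<Rightarrow> bool"
  where "dense_in P D \<longleftrightarrow> D \<subseteq> Field P \<and> (\<forall>p\<in>Field P. \<exists>q\<in>D. (q, p) \<in> P)"

definition filter_on :: "'p rel \<Rightarrow> 'p set \<Rightarrow> bool"
  where "filter_on P G \<longleftrightarrow> G \<subseteq> Field P \<and> G \<noteq> {} \<and>
    (\<forall>p\<in>G. \<forall>q. (p, q) \<in> P \<longrightarrow> q \<in> G) \<and>
    (\<forall>p\<in>G. \<forall>q\<in>G. \<exists>s\<in>G. (s, p) \<in> P \<and> (s, q) \<in> P)"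

text \<open>A formula of the forcing language is represented by the predicate on conditions
  ``\<open>p\<close> forces it'', and the operations below are the usual recursive clauses of the forcing
  relation. Quantifiers range over elements of ground model sets, or over names for subsets of a
  ground model set \<open>X\<close>. Every such subset in an extension has a name all of whose elements
  are pairs \<open>(x, p)\<close> with \<open>x \<in> X\<close> and \<open>p\<close> a condition, so these are the only names needed.
  Pairs \<open>(x, p)\<close> with \<open>p \<notin> Field P\<close> have no effect.\<close>

type_synonym 'p fm = "'p \<Rightarrow> bool"
type_synonym ('x, 'p) nam = "('x \<times> 'p) set"

definition fm_ground :: "bool \<Rightarrow> 'p fm"
  where "fm_ground b = (\<lambda>p. b)"

definition fm_mem :: "'p rel \<Rightarrow> 'x \<Rightarrow> ('x, 'p) nam \<Rightarrow> 'p fm"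
  where "fm_mem P x N =
    (\<lambda>p. \<forall>q. (q, p) \<in> P \<longrightarrow> (\<exists>s. (s, q) \<in> P \<and> (\<exists>t. (x, t) \<in> N \<and> (s, t) \<in> P)))"

definition fm_not :: "'p rel \<Rightarrow> 'p fm \<Rightarrow> 'p fm"
  where "fm_not P \<phi> = (\<lambda>p. \<forall>q. (q, p) \<in> P \<longrightarrow> \<not> \<phi> q)"

definition fm_and :: "'p fm \<Rightarrow> 'p fm \<Rightarrow> 'p fm"
  where "fm_and \<phi> \<psi> = (\<lambda>p. \<phi> p \<and> \<psi> p)"

definition fm_all :: "('x \<Rightarrow> 'p fm) \<Rightarrow> 'p fm"
  where "fm_all \<Phi> = (\<lambda>p. \<forall>x. \<Phi> x p)"

definition fm_imp :: "'p rel \<Rightarrow> 'p fm \<Rightarrow> 'p fm \<Rightarrow> 'p fm"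
  where "fm_imp P \<phi> \<psi> = fm_not P (fm_and \<phi> (fm_not P \<psi>))"

definition fm_ex :: "'p rel \<Rightarrow> ('x \<Rightarrow> 'p fm) \<Rightarrow> 'p fm"
  where "fm_ex P \<Phi> = fm_not P (fm_all (\<lambda>x. fm_not P (\<Phi> x)))"

definition forces :: "'p rel \<Rightarrow> 'p fm \<Rightarrow> bool"
  where "forces P \<phi> \<longleftrightarrow> (\<forall>p\<in>Field P. \<phi> p)"

text \<open>The name \<open>e\<close> stands for the graph of an injection from \<open>N\<close> to \<open>\<omega>\<close>.\<close>

definition fm_countable :: "'p rel \<Rightarrow> ('x, 'p) nam \<Rightarrow> 'p fm"
  where "fm_countable P N = fm_ex P (\<lambda>e :: ('x \<times> nat, 'p) nam.
    fm_and (fm_all (\<lambda>x. fm_imp P (fm_mem P x N) (fm_ex P (\<lambda>k. fm_mem P (x, k) e))))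
    (fm_and
      (fm_all (\<lambda>x. fm_all (\<lambda>k. fm_all (\<lambda>k'.
        fm_imp P (fm_and (fm_mem P (x, k) e) (fm_mem P (x, k') e)) (fm_ground (k = k'))))))
      (fm_all (\<lambda>x. fm_all (\<lambda>y. fm_all (\<lambda>k.
        fm_imp P (fm_and (fm_mem P (x, k) e) (fm_mem P (y, k) e)) (fm_ground (x = y))))))))"

text \<open>The formula defining \<^const>\<open>n_capturing\<close>, with ``infinitely many \<open>l\<close>'' read as
  unboundedly many. A ccc extension has the same finite sets of ordinals and the same \<open>\<omega>\<^sub>1\<close>,
  and \<^const>\<open>captured_family\<close> is absolute, so \<open>S\<close> is the only quantifier over new objects.\<close>

definition fm_n_capturing :: "'p rel \<Rightarrow> scheme_type \<Rightarrow> omega1 set set \<Rightarrow> nat \<Rightarrow> 'p fm"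
  where "fm_n_capturing P \<tau> \<F> n = fm_all (\<lambda>S :: (omega1 set, 'p) nam.
    fm_imp P
      (fm_and (fm_all (\<lambda>A. fm_imp P (fm_mem P A S) (fm_ground (finite A))))
        (fm_not P (fm_countable P S)))
      (fm_all (\<lambda>k :: nat. fm_ex P (\<lambda>l. fm_ex P (\<lambda>D :: nat \<Rightarrow> omega1 set.
        fm_and
          (fm_ground (k \<le> l \<and> inj_on D {..<n} \<and> captured_family \<tau> \<F> l n D))
          (fm_all (\<lambda>i. fm_imp P (fm_ground (i < n)) (fm_mem P (D i) S))))))))"


section \<open>The cardinal invariants\<close>

definition unmet :: "'p rel \<Rightarrow> 'p set set \<Rightarrow> bool"
  where "unmet P \<D> \<longleftrightarrow> (\<forall>D\<in>\<D>. dense_in P D) \<and>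
    \<not> (\<exists>G. filter_on P G \<and> (\<forall>D\<in>\<D>. G \<inter> D \<noteq> {}))"

text \<open>\<open>\<kappa> = \<mm>(P)\<close>; no \<open>\<kappa>\<close> qualifies if a single filter meets all dense sets.\<close>

definition is_m :: "'p rel \<Rightarrow> 'p set rel \<Rightarrow> bool"
  where "is_m P \<kappa> \<longleftrightarrow>
    (\<exists>\<D>. unmet P \<D> \<and> \<kappa> =o |\<D>| ) \<and> (\<forall>\<D>. unmet P \<D> \<longrightarrow> \<kappa> \<le>o |\<D>| )"

text \<open>\<open>\<kappa>\<close> is the least \<open>\<mm>(P)\<close> over the ccc posets \<open>P\<close> with carrier in the type \<open>'p\<close> that force
  \<open>\<F>\<close> to be \<open>n\<close>-capturing. Once \<open>'p\<close> has at least continuum many elements this is \<open>\<mm>\<^sup>n\<^sub>\<F>\<close>: the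
  value is at most the continuum, because of Cohen forcing, and a family of \<open>\<kappa>\<close> dense sets witnessing
  it survives in a suborder of size \<open>\<kappa>\<close> taken closed enough to retain ccc, compatibility of
  finitely many conditions, and thus the forcing of \<open>n\<close>-capturing.\<close>

definition is_m_capturing ::
  "scheme_type \<Rightarrow> omega1 set set \<Rightarrow> nat \<Rightarrow> 'p set rel \<Rightarrow> bool"
  where "is_m_capturing \<tau> \<F> n \<kappa> \<longleftrightarrow>
    (\<exists>P :: 'p rel. poset P \<and> ccc P \<and> forces P (fm_n_capturing P \<tau> \<F> n) \<and> is_m P \<kappa>) \<and>
    (\<forall>(P :: 'p rel) \<mu>. poset P \<and> ccc P \<and> forces P (fm_n_capturing P \<tau> \<F> n) \<and> is_m P \<mu>
        \<longrightarrow> \<kappa> \<le>o \<mu>)"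


section \<open>Ramsey ultrafilters\<close>

definition pi_set :: "scheme_type \<Rightarrow> omega1 set set \<Rightarrow> nat \<Rightarrow> omega1 set \<Rightarrow> nat set"
  where "pi_set \<tau> \<F> n S =
    {rho_set \<tau> \<F> D |D. D \<subseteq> S \<and> finite D \<and> card D = n \<and> (\<exists>l. captured_set \<tau> \<F> l D)}"

definition U_family :: "scheme_type \<Rightarrow> omega1 set set \<Rightarrow> nat \<Rightarrow> nat set set"
  where "U_family \<tau> \<F> n =
    {A. \<exists>S :: omega1 set. |S| =o cardSuc natLeq \<and> pi_set \<tau> \<F> n S \<subseteq> A}"

text \<open>As usual for ultrafilters on \<open>\<omega>\<close>, nonprincipality is part of the definition.\<close>

definition ultrafilter :: "nat set set \<Rightarrow> bool"
  where "ultrafilter \<U> \<longleftrightarrow>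
    UNIV \<in> \<U> \<and> {} \<notin> \<U> \<and>
    (\<forall>A\<in>\<U>. \<forall>B. A \<subseteq> B \<longrightarrow> B \<in> \<U>) \<and>
    (\<forall>A\<in>\<U>. \<forall>B\<in>\<U>. A \<inter> B \<in> \<U>) \<and>
    (\<forall>A. A \<in> \<U> \<or> - A \<in> \<U>) \<and>
    (\<forall>x. {x} \<notin> \<U>)"

definition Ramsey_ultrafilter :: "nat set set \<Rightarrow> bool"
  where "Ramsey_ultrafilter \<U> \<longleftrightarrow> ultrafilter \<U> \<and>
    (\<forall>\<P>. partition_on UNIV \<P> \<and> infinite \<P> \<and> (\<forall>X\<in>\<P>. X \<notin> \<U>) \<longrightarrow>
      (\<exists>A\<in>\<U>. \<forall>X\<in>\<P>. \<forall>x\<in>A \<inter> X. \<forall>y\<in>A \<inter> X. x = y))"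

end

theory Submission
  imports Defs
begin

text \<open>Call a tuple \<open>t\<^sub>0 < \<dots> < t\<^sub>n\<^sub>-\<^sub>1\<close> of ordinals captured at level \<open>l\<close> if its singletons are. Everything
  rests on one observation: the norm \<open>\<parallel>\<alpha>\<parallel>\<^sub>k\<close> is the position of \<open>\<alpha>\<close> in any member of \<open>\<F>\<^sub>k\<close> containing it,
  and \<open>\<parallel>\<alpha>\<parallel>\<^sub>k\<^sub>+\<^sub>1\<close> is computed from \<open>\<parallel>\<alpha>\<parallel>\<^sub>k\<close> and the index of the block containing \<open>\<alpha>\<close>. Hence if finite sets
  \<open>D\<^sub>i\<close> lie below \<open>t\<^sub>i\<close>, with \<open>\<rho>(t\<^sub>i, \<xi>) \<le> k\<close> for \<open>\<xi> \<in> D\<^sub>i\<close> and the same norms at \<open>k\<close>, then capturing the \<open>t\<^sub>i\<close> captures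
  the \<open>D\<^sub>i\<close>, and every captured \<open>n\<close>-subset of \<open>\<Union>\<^sub>i D\<^sub>i\<close> is contained in one \<open>D\<^sub>i\<close> or captured at level \<open>l\<close>.
  So by pigeonhole every uncountable family of finite sets is controlled by an uncountable set of
  ordinals, which can be chosen inside any prescribed uncountable \<open>S\<close>.

  Let \<open>C\<close> be a property of sets of levels, closed under subsets, such that each finite \<open>Q\<close> with \<open>C\<close> and
  each uncountable \<open>T \<subseteq> S\<close> admit \<open>l \<in> \<pi>\<^sub>n(T)\<close> with \<open>C (Q \<union> {l})\<close>. Then the poset of
  finite \<open>p \<subseteq> S\<close> with \<open>C (\<pi>\<^sub>n(p))\<close> is ccc and forces \<open>\<F>\<close> to be \<open>n\<close>-capturing, so some uncountable \<open>S' \<subseteq> S\<close> has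
  \<open>C (\<pi>\<^sub>n(p))\<close> for all finite \<open>p \<subseteq> S'\<close>. Taking \<open>C Q\<close> to be \<open>Q \<subseteq> A\<close> gives the ultrafilter, and taking
  it to be ``\<open>Q\<close> meets each piece of the partition at most once'' gives the Ramsey property.\<close>

section \<open>Norms in a construction scheme\<close>

locale scheme =
  fixes \<tau> :: scheme_type and \<F> :: "omega1 set set"
  assumes good: "good_type \<tau>" and cs: "construction_scheme \<tau> \<F>"
begin

abbreviation "m \<equiv> mm \<tau>"
abbreviation "r \<equiv> rr \<tau>"
abbreviation "lev \<equiv> level \<tau> \<F>"
abbreviation "\<rho> \<equiv> rho \<tau> \<F>"
abbreviation "nrm \<equiv> norm_at \<tau> \<F>"

section \<open>Sizes and downward closure of the levels\<close>

lemma r_less_m: "r (Suc k) < m k"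
  using good unfolding good_type_def by blast

lemma m_strict_mono: "strict_mono m"
proof (rule strict_mono_Suc_iff[THEN iffD2, rule_format])
  fix k
  have 1: "m (Suc k) = r (Suc k) + (m k - r (Suc k)) * nn \<tau> (Suc k)" and 2: "2 \<le> nn \<tau> (Suc k)"
    using good unfolding good_type_def by blast+
  have "(m k - r (Suc k)) * 2 \<le> (m k - r (Suc k)) * nn \<tau> (Suc k)"
    using 2 by simp
  then show "m k < m (Suc k)"
    using 1 r_less_m[of k] by linarith
qed

lemma level_finite: "E \<in> lev k \<Longrightarrow> finite E"
  and level_card: "E \<in> lev k \<Longrightarrow> card E = m k"
  using cs unfolding construction_scheme_def level_def by auto

lemma in_some_level: "F \<in> \<F> \<Longrightarrow> \<exists>k. F \<in> lev k"
  using cs unfolding construction_scheme_def level_def by blast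

lemma obtain_decomposition:
  assumes "F \<in> lev (Suc k)"
  obtains G R where "decomposition \<tau> \<F> (Suc k) F G R"
  using cs assms unfolding construction_scheme_def by blast

lemma level_initial:
  assumes "E \<in> lev k" "F \<in> lev k" "\<beta> \<in> E" "\<beta> \<in> F" "\<alpha> \<in> E" "\<alpha> \<le> \<beta>"
  shows "\<alpha> \<in> F"
proof -
  have "initial_segment (E \<inter> F) E"
    using cs assms(1,2) unfolding construction_scheme_def by blast
  then show ?thesis
    using assms(3-6) unfolding initial_segment_def by (metis IntI IntD2 le_less)
qed

lemma level_down:
  assumes "j \<le> k" "F \<in> lev k" "\<alpha> \<in> F"
  shows "\<exists>E\<in>lev j. \<alpha> \<in> E \<and> E \<subseteq> F"
  using assms
proof (induction k arbitrary: F rule: dec_induct)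
  case base
  then show ?case by blast
next
  case (step k)
  obtain G R where "decomposition \<tau> \<F> (Suc k) F G R"
    using obtain_decomposition step.prems(1) by blast
  then obtain i where i: "G i \<in> lev k" "\<alpha> \<in> G i" "G i \<subseteq> F"
    using step.prems(2) unfolding decomposition_def by auto
  then obtain E where "E \<in> lev j" "\<alpha> \<in> E" "E \<subseteq> G i"
    using step.IH[OF i(1,2)] by blast
  then show ?case
    using i(3) by (meson subset_trans)
qed

text \<open>A member containing \<alpha> together with \<open>m k\<close> points has level at least
  \<open>k\<close>, because \<open>m\<close> is increasing; decompositions then lead down to level
  \<open>k\<close> around \<alpha>.\<close>

lemma level_cover: "\<exists>E\<in>lev k. \<alpha> \<in> E"
proof -
  have "infinite (UNIV :: omega1 set)"
    using uncountable_omega1 countable_finite by blast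
  then obtain B :: "omega1 set" where B: "finite B" "card B = m k"
    using infinite_arbitrarily_large by blast
  then obtain F where F: "F \<in> \<F>" "insert \<alpha> B \<subseteq> F"
    using cs unfolding construction_scheme_def by (metis finite_insert)
  then obtain K where K: "F \<in> lev K"
    using in_some_level by blast
  have "m k \<le> m K"
    using B F level_card[OF K] level_finite[OF K] by (metis card_mono insert_subset)
  then have "k \<le> K"
    using m_strict_mono by (simp add: strict_mono_less_eq)
  moreover have "\<alpha> \<in> F" using F(2) by simp
  ultimately show ?thesis
    using level_down[OF _ K] by meson
qed

lemma level_closed:
  assumes "j \<le> k" "E \<in> lev j" "F \<in> lev k" "\<beta> \<in> E" "\<beta> \<in> F" "\<alpha> \<in> E" "\<alpha> \<le> \<beta>"
  shows "\<alpha> \<in> F"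
proof -
  obtain E' where "E' \<in> lev j" "\<beta> \<in> E'" "E' \<subseteq> F"
    using level_down[OF assms(1,3,5)] by blast
  then show ?thesis
    using level_initial[OF assms(2) _ assms(4) _ assms(6,7)] by (meson subsetD)
qed

section \<open>Norms as positions, and their recursion over levels\<close>

lemma rho_commute: "\<rho> \<alpha> \<beta> = \<rho> \<beta> \<alpha>"
  by (simp add: rho_def insert_commute)

text \<open>Cofinality makes the minimum in \<rho> attained, and \<open>level_closed\<close> carries
  a witness of smaller level into \<open>F\<close>. So the points up to \<alpha> within
  \<rho>-distance \<open>k\<close> can be read off from any member of level \<open>k\<close>
  containing \<alpha>.\<close>

lemma rho_le_iff:
  assumes "F \<in> lev k" "\<alpha> \<in> F" "\<xi> \<le> \<alpha>"
  shows "\<rho> \<alpha> \<xi> \<le> k \<longleftrightarrow> \<xi> \<in> F"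
proof
  have "\<exists>F\<in>\<F>. {\<alpha>, \<xi>} \<subseteq> F"
    using cs unfolding construction_scheme_def by (meson finite.emptyI finite.insertI)
  then have "\<exists>j. \<exists>E\<in>lev j. {\<alpha>, \<xi>} \<subseteq> E"
    using in_some_level by meson
  then have "\<exists>E\<in>lev (\<rho> \<alpha> \<xi>). {\<alpha>, \<xi>} \<subseteq> E"
    unfolding rho_def by (rule LeastI_ex)
  then obtain E where E: "E \<in> lev (\<rho> \<alpha> \<xi>)" "\<alpha> \<in> E" "\<xi> \<in> E"
    by auto
  show "\<rho> \<alpha> \<xi> \<le> k \<Longrightarrow> \<xi> \<in> F"
    by (rule level_closed[OF _ E(1) assms(1) E(2) assms(2) E(3) assms(3)])
next
  show "\<xi> \<in> F \<Longrightarrow> \<rho> \<alpha> \<xi> \<le> k"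
    using assms unfolding rho_def by (intro Least_le) auto
qed

lemma rho_self: "\<rho> \<alpha> \<alpha> = 0"
  using level_cover[of 0 \<alpha>] rho_le_iff[of _ 0 \<alpha> \<alpha>] by (metis le_zero_eq order_refl)

lemma norm_eq_card:
  assumes "F \<in> lev k" "\<alpha> \<in> F"
  shows "nrm \<alpha> k = card (F \<inter> {..<\<alpha>})"
proof -
  have "{\<xi>. \<xi> < \<alpha> \<and> \<rho> \<alpha> \<xi> \<le> k} = F \<inter> {..<\<alpha>}"
    using rho_le_iff[OF assms] by auto
  then show ?thesis by (simp add: norm_at_def)
qed

lemma norm_strict_mono:
  assumes "F \<in> lev k" "\<alpha> \<in> F" "\<beta> \<in> F" "\<alpha> < \<beta>"
  shows "nrm \<alpha> k < nrm \<beta> k"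
proof -
  have "F \<inter> {..<\<alpha>} \<subset> F \<inter> {..<\<beta>}"
    using assms by auto
  then show ?thesis
    using assms level_finite by (simp add: norm_eq_card psubset_card_mono)
qed

lemma norm_less_iff:
  assumes "F \<in> lev k" "\<alpha> \<in> F" "\<beta> \<in> F"
  shows "nrm \<alpha> k < nrm \<beta> k \<longleftrightarrow> \<alpha> < \<beta>"
  using norm_strict_mono[OF assms(1)] assms(2,3) by (metis linorder_less_linear less_asym')

lemma norm_inject:
  assumes "F \<in> lev k" "\<alpha> \<in> F" "\<beta> \<in> F" "nrm \<alpha> k = nrm \<beta> k"
  shows "\<alpha> = \<beta>"
  using norm_less_iff[OF assms(1)] assms(2-4) by (metis linorder_less_linear less_irrefl)

text \<open>Below a root point, both \<open>F\<close> and the block contain only root points. Below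
  a point of the tail of \<open>G a\<close>, \<open>F\<close> contains what \<open>G a\<close>
  contains there and the full tails of the earlier blocks, each of size
  \<open>m k - r (Suc k)\<close>.\<close>

lemma norm_Suc:
  assumes dec: "decomposition \<tau> \<F> (Suc k) F G R" and F: "F \<in> lev (Suc k)"
    and a: "a < nn \<tau> (Suc k)" and \<alpha>: "\<alpha> \<in> G a"
  shows "nrm \<alpha> k < r (Suc k) \<longleftrightarrow> \<alpha> \<in> R"
    and "\<alpha> \<in> R \<Longrightarrow> nrm \<alpha> (Suc k) = nrm \<alpha> k"
    and "\<alpha> \<notin> R \<Longrightarrow> nrm \<alpha> (Suc k) = nrm \<alpha> k + a * (m k - r (Suc k))"
    and "nrm \<alpha> k < m k"
proof -
  have FG: "F = (\<Union>i<nn \<tau> (Suc k). G i)" and G: "\<And>i. i < nn \<tau> (Suc k) \<Longrightarrow> G i \<in> lev k"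
    and cR: "card R = r (Suc k)" and rtt: "root_tail_tail (nn \<tau> (Suc k)) G R"
    using dec unfolding decomposition_def by auto
  have RG: "R \<subseteq> G i" if "i < nn \<tau> (Suc k)" for i
    using rtt that unfolding root_tail_tail_def by simp
  have R_less: "x < y" if "i < nn \<tau> (Suc k)" "x \<in> R" "y \<in> G i" "y \<notin> R" for i x y
    using rtt that unfolding root_tail_tail_def set_less_def by simp
  have GG: "G i \<inter> G j = R" if "i < nn \<tau> (Suc k)" "j < nn \<tau> (Suc k)" "i \<noteq> j" for i j
    using rtt that unfolding root_tail_tail_def by simp
  have G_less: "x < y"
    if "i < j" "j < nn \<tau> (Suc k)" "x \<in> G i" "x \<notin> R" "y \<in> G j" "y \<notin> R" for i j x y
  proof -
    have "i < nn \<tau> (Suc k)" using that(1,2) by simp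
    then have "set_less (G i - R) (G j - R)"
      using rtt that(1,2) unfolding root_tail_tail_def by simp
    then show ?thesis using that(3-6) unfolding set_less_def by simp
  qed
  have finG: "\<And>i. i < nn \<tau> (Suc k) \<Longrightarrow> finite (G i)"
    using G level_finite by blast
  have finR: "finite R" using RG[OF a] finG[OF a] finite_subset by blast
  have \<alpha>F: "\<alpha> \<in> F" using FG a \<alpha> by blast
  have nk: "nrm \<alpha> k = card (G a \<inter> {..<\<alpha>})"
    and nSk: "nrm \<alpha> (Suc k) = card (F \<inter> {..<\<alpha>})"
    by (rule norm_eq_card[OF G[OF a] \<alpha>], rule norm_eq_card[OF F \<alpha>F])
  have in_R: "nrm \<alpha> k < r (Suc k) \<and> nrm \<alpha> (Suc k) = nrm \<alpha> k" if "\<alpha> \<in> R"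
  proof -
    have 1: "G a \<inter> {..<\<alpha>} = R \<inter> {..<\<alpha>}"
      using RG[OF a] R_less[OF a that] by (auto dest: less_asym)
    have 2: "F \<inter> {..<\<alpha>} = R \<inter> {..<\<alpha>}"
      using RG[OF a] FG R_less[OF _ that] a by (auto dest: less_asym)
    have "R \<inter> {..<\<alpha>} \<subset> R" using that by auto
    then have "card (R \<inter> {..<\<alpha>}) < card R" using finR by (rule psubset_card_mono[rotated])
    then show ?thesis using 1 2 nk nSk cR by simp
  qed
  have notin_R: "r (Suc k) \<le> nrm \<alpha> k \<and> nrm \<alpha> (Suc k) = nrm \<alpha> k + a * (m k - r (Suc k))"
    if "\<alpha> \<notin> R"
  proof
    have "R \<subseteq> G a \<inter> {..<\<alpha>}" using RG[OF a] R_less[OF a _ \<alpha> that] by auto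
    then show "r (Suc k) \<le> nrm \<alpha> k"
      using nk cR finG[OF a] by (metis card_mono finite_Int)
    have eq: "F \<inter> {..<\<alpha>} = (G a \<inter> {..<\<alpha>}) \<union> (\<Union>j<a. G j - R)"
    proof (intro equalityI subsetI)
      fix x assume x: "x \<in> F \<inter> {..<\<alpha>}"
      then obtain j where j: "j < nn \<tau> (Suc k)" "x \<in> G j" using FG by auto
      show "x \<in> (G a \<inter> {..<\<alpha>}) \<union> (\<Union>j<a. G j - R)"
      proof (cases "x \<in> R")
        case True
        then show ?thesis using RG[OF a] x by auto
      next
        case False
        then have "j \<le> a" using G_less[OF _ j(1) \<alpha> that j(2)] x
          by (metis IntD2 lessThan_iff less_asym' not_le_imp_less)
        then show ?thesis using False j x by (cases "j = a") auto
      qed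
    next
      fix x assume "x \<in> (G a \<inter> {..<\<alpha>}) \<union> (\<Union>j<a. G j - R)"
      then show "x \<in> F \<inter> {..<\<alpha>}"
        using FG a G_less[OF _ a _ _ \<alpha> that] less_trans[OF _ a] by auto
    qed
    have disj: "(G a \<inter> {..<\<alpha>}) \<inter> (\<Union>j<a. G j - R) = {}"
      using GG[OF a] less_trans[OF _ a] by blast
    have "card (\<Union>j<a. G j - R) = (\<Sum>j<a. card (G j - R))"
    proof (rule card_UN_disjoint)
      show "\<forall>i\<in>{..<a}. \<forall>j\<in>{..<a}. i \<noteq> j \<longrightarrow> (G i - R) \<inter> (G j - R) = {}"
        using GG less_trans[OF _ a] by blast
    qed (use finG a in auto)
    also have "\<dots> = (\<Sum>j<a. m k - r (Suc k))"
      using a RG G finR cR by (intro sum.cong) (auto simp: card_Diff_subset level_card[OF G])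
    finally have "card (\<Union>j<a. G j - R) = a * (m k - r (Suc k))" by simp
    moreover have "card (F \<inter> {..<\<alpha>}) = card (G a \<inter> {..<\<alpha>}) + card (\<Union>j<a. G j - R)"
      unfolding eq using finG a by (intro card_Un_disjoint disj) auto
    ultimately show "nrm \<alpha> (Suc k) = nrm \<alpha> k + a * (m k - r (Suc k))"
      using nk nSk by simp
  qed
  show "nrm \<alpha> k < r (Suc k) \<longleftrightarrow> \<alpha> \<in> R"
    using in_R notin_R by (meson leD)
  show "\<alpha> \<in> R \<Longrightarrow> nrm \<alpha> (Suc k) = nrm \<alpha> k"
    using in_R by blast
  show "\<alpha> \<notin> R \<Longrightarrow> nrm \<alpha> (Suc k) = nrm \<alpha> k + a * (m k - r (Suc k))"
    using notin_R by blast
  have "G a \<inter> {..<\<alpha>} \<subset> G a" using \<alpha> by auto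
  then show "nrm \<alpha> k < m k"
    using nk finG[OF a] level_card[OF G[OF a]] by (metis psubset_card_mono)
qed

text \<open>Off the root, the position inside the tail is smaller than the tail length, so division
  by that length returns the block index as quotient and the position as remainder. Thus the norm at
  \<open>Suc k\<close> alone determines the norm at \<open>k\<close>.\<close>

lemma norm_Suc_inverse:
  assumes dec: "decomposition \<tau> \<F> (Suc k) F G R" and F: "F \<in> lev (Suc k)"
    and a: "a < nn \<tau> (Suc k)" and \<alpha>: "\<alpha> \<in> G a"
  shows "nrm \<alpha> (Suc k) < r (Suc k) \<longleftrightarrow> \<alpha> \<in> R"
    and "\<alpha> \<notin> R \<Longrightarrow> (nrm \<alpha> (Suc k) - r (Suc k)) div (m k - r (Suc k)) = a"
    and "\<alpha> \<notin> R \<Longrightarrow> r (Suc k) + (nrm \<alpha> (Suc k) - r (Suc k)) mod (m k - r (Suc k)) = nrm \<alpha> k"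
proof -
  note * = norm_Suc[OF assms]
  show "nrm \<alpha> (Suc k) < r (Suc k) \<longleftrightarrow> \<alpha> \<in> R"
    using * by (cases "\<alpha> \<in> R") auto
  assume R: "\<alpha> \<notin> R"
  let ?d = "m k - r (Suc k)"
  have 1: "nrm \<alpha> (Suc k) - r (Suc k) = (nrm \<alpha> k - r (Suc k)) + a * ?d"
    and 2: "nrm \<alpha> k - r (Suc k) < ?d" and 3: "r (Suc k) \<le> nrm \<alpha> k"
    using * R r_less_m[of k] by auto
  have "?d \<noteq> 0" using r_less_m[of k] by simp
  then have "(nrm \<alpha> k - r (Suc k) + a * ?d) div ?d = a"
    "(nrm \<alpha> k - r (Suc k) + a * ?d) mod ?d = nrm \<alpha> k - r (Suc k)"
    using 2 by simp_all
  then show "(nrm \<alpha> (Suc k) - r (Suc k)) div ?d = a"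
    "r (Suc k) + (nrm \<alpha> (Suc k) - r (Suc k)) mod ?d = nrm \<alpha> k"
    unfolding 1 using 3 by simp_all
qed

lemma obtain_block:
  obtains F G R a where "F \<in> lev (Suc k)" "decomposition \<tau> \<F> (Suc k) F G R"
    "a < nn \<tau> (Suc k)" "\<alpha> \<in> G a" "G a \<in> lev k"
proof -
  obtain F where F: "F \<in> lev (Suc k)" "\<alpha> \<in> F" using level_cover by blast
  obtain G R where dec: "decomposition \<tau> \<F> (Suc k) F G R"
    using obtain_decomposition F(1) by blast
  then obtain a where "a < nn \<tau> (Suc k)" "\<alpha> \<in> G a" "G a \<in> lev k"
    using F(2) unfolding decomposition_def by auto
  then show ?thesis using that F dec by blast
qed

lemma norm_eq_down_Suc:
  assumes "nrm \<alpha> (Suc k) = nrm \<beta> (Suc k)"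
  shows "nrm \<alpha> k = nrm \<beta> k"
proof -
  obtain F G R a where *: "F \<in> lev (Suc k)" "decomposition \<tau> \<F> (Suc k) F G R"
    "a < nn \<tau> (Suc k)" "\<alpha> \<in> G a" by (rule obtain_block)
  obtain F' G' R' a' where **: "F' \<in> lev (Suc k)" "decomposition \<tau> \<F> (Suc k) F' G' R'"
    "a' < nn \<tau> (Suc k)" "\<beta> \<in> G' a'" by (rule obtain_block)
  note A = norm_Suc_inverse[OF *(2,1,3,4)] norm_Suc[OF *(2,1,3,4)]
  note B = norm_Suc_inverse[OF **(2,1,3,4)] norm_Suc[OF **(2,1,3,4)]
  show ?thesis
    using A(1) B(1) A(3) B(3) A(5) B(5) assms by metis
qed

lemma norm_eq_down:
  assumes "j \<le> k" "nrm \<alpha> k = nrm \<beta> k"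
  shows "nrm \<alpha> j = nrm \<beta> j"
  using assms by (induction k rule: dec_induct) (auto dest: norm_eq_down_Suc)

text \<open>Each of \<xi>, \<xi>' shares a block with its \<open>t\<close>, \<open>t'\<close>, and
  the common norm of \<open>t\<close> and \<open>t'\<close> at \<open>Suc k\<close> determines
  whether they are root points and, if not, the index of that block.\<close>

lemma norm_eq_up_Suc:
  assumes le: "\<xi> \<le> t" "\<xi>' \<le> t'" and rho: "\<rho> t \<xi> \<le> k" "\<rho> t' \<xi>' \<le> k"
    and t: "nrm t (Suc k) = nrm t' (Suc k)" and eq: "nrm \<xi> k = nrm \<xi>' k"
  shows "nrm \<xi> (Suc k) = nrm \<xi>' (Suc k)"
proof -
  obtain F G R a where *: "F \<in> lev (Suc k)" "decomposition \<tau> \<F> (Suc k) F G R"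
    "a < nn \<tau> (Suc k)" "t \<in> G a" "G a \<in> lev k" by (rule obtain_block)
  obtain F' G' R' a' where **: "F' \<in> lev (Suc k)" "decomposition \<tau> \<F> (Suc k) F' G' R'"
    "a' < nn \<tau> (Suc k)" "t' \<in> G' a'" "G' a' \<in> lev k" by (rule obtain_block)
  have \<xi>: "\<xi> \<in> G a" and \<xi>': "\<xi>' \<in> G' a'"
    using rho_le_iff[OF *(5,4) le(1)] rho_le_iff[OF **(5,4) le(2)] rho by auto
  note A = norm_Suc_inverse[OF *(2,1,3,4)] norm_Suc[OF *(2,1,3,4)] norm_Suc[OF *(2,1,3) \<xi>]
  note B = norm_Suc_inverse[OF **(2,1,3,4)] norm_Suc[OF **(2,1,3,4)] norm_Suc[OF **(2,1,3) \<xi>']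
  show ?thesis
  proof (cases "t \<in> R")
    case True
    \<comment> \<open>The root is an initial segment of the block, so \<xi> \<le> \<open>t\<close>
      forces \<xi> into it as well.\<close>
    have "nrm \<xi> k \<le> nrm t k"
      using norm_less_iff[OF *(5,4) \<xi>] le(1) by (meson leD not_le_imp_less)
    then have "\<xi> \<in> R" using True A(4) A(8) by linarith
    then show ?thesis using A(8,9) B(8,9) eq by simp
  next
    case False
    then have "a = a'" using A(1,2) B(1,2) t by metis
    then show ?thesis using A(8,9,10) B(8,9,10) eq by metis
  qed
qed

lemma norm_eq_transfer:
  assumes le: "\<xi> \<le> t" "\<xi>' \<le> t'" and rho: "\<rho> t \<xi> \<le> k" "\<rho> t' \<xi>' \<le> k"
    and eq: "nrm \<xi> k = nrm \<xi>' k" and "k \<le> L" and "nrm t L = nrm t' L"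
  shows "nrm \<xi> L = nrm \<xi>' L"
  using assms(6,7)
proof (induction L rule: dec_induct)
  case base
  then show ?case using eq by simp
next
  case (step L)
  then have "nrm \<xi> L = nrm \<xi>' L" using norm_eq_down_Suc by blast
  then show ?case
    using norm_eq_up_Suc[OF le _ _ step.prems] rho step.hyps by simp
qed

text \<open>The value \<open>v\<close> is computed from the norm at \<open>Suc k\<close> only, so
  every member and every decomposition gives the same answer and the definite description in
  \<open>Xi\<close> is well defined.\<close>

lemma Xi_eq:
  assumes dec: "decomposition \<tau> \<F> (Suc k) F G R" and F: "F \<in> lev (Suc k)"
    and a: "a < nn \<tau> (Suc k)" and \<alpha>: "\<alpha> \<in> G a"
  shows "Xi \<tau> \<F> \<alpha> (Suc k) = (if \<alpha> \<in> R then - 1 else int a)"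
proof -
  define v where "v = (if nrm \<alpha> (Suc k) < r (Suc k) then - 1
    else int ((nrm \<alpha> (Suc k) - r (Suc k)) div (m k - r (Suc k))))"
  have R: "R' \<subseteq> G' i"
    if "decomposition \<tau> \<F> (Suc k) F' G' R'" "i < nn \<tau> (Suc k)" for F' G' R' i
    using that by (simp add: decomposition_def root_tail_tail_def)
  have v: "v = (if \<alpha> \<in> R' then - 1 else int i)"
    if "decomposition \<tau> \<F> (Suc k) F' G' R'" "F' \<in> lev (Suc k)" "i < nn \<tau> (Suc k)" "\<alpha> \<in> G' i"
    for F' G' R' i
    unfolding v_def norm_Suc_inverse(1)[OF that] using norm_Suc_inverse(2)[OF that] by simp
  have "Xi \<tau> \<F> \<alpha> (Suc k) = v"
    unfolding Xi_def if_not_P[OF nat.distinct(2)]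
  proof (rule the_equality)
    show "\<exists>F\<in>lev (Suc k). \<exists>G R. \<alpha> \<in> F \<and> decomposition \<tau> \<F> (Suc k) F G R \<and>
            (\<alpha> \<in> R \<and> v = -1 \<or> (\<exists>i<nn \<tau> (Suc k). \<alpha> \<in> G i - R \<and> v = int i))"
    proof (intro bexI exI conjI)
      show "\<alpha> \<in> F" using dec a \<alpha> unfolding decomposition_def by blast
      show "\<alpha> \<in> R \<and> v = -1 \<or> (\<exists>i<nn \<tau> (Suc k). \<alpha> \<in> G i - R \<and> v = int i)"
        using v[OF assms] a \<alpha> by auto
    qed (fact dec F)+
  next
    fix x
    assume "\<exists>F\<in>lev (Suc k). \<exists>G R. \<alpha> \<in> F \<and> decomposition \<tau> \<F> (Suc k) F G R \<and>
            (\<alpha> \<in> R \<and> x = -1 \<or> (\<exists>i<nn \<tau> (Suc k). \<alpha> \<in> G i - R \<and> x = int i))"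
    then obtain F' G' R' where 1: "F' \<in> lev (Suc k)" "decomposition \<tau> \<F> (Suc k) F' G' R'"
      and 2: "\<alpha> \<in> R' \<and> x = -1 \<or> (\<exists>i<nn \<tau> (Suc k). \<alpha> \<in> G' i \<and> \<alpha> \<notin> R' \<and> x = int i)"
      by blast
    show "x = v"
      using 2
    proof (elim disjE exE conjE)
      assume "\<alpha> \<in> R'" "x = -1"
      then show ?thesis using v[OF 1(2,1) a] R[OF 1(2) a] by auto
    next
      fix i assume "i < nn \<tau> (Suc k)" "\<alpha> \<in> G' i" "\<alpha> \<notin> R'" "x = int i"
      then show ?thesis using v[OF 1(2,1)] by auto
    qed
  qed
  then show ?thesis using v[OF assms] by simp
qed

end

section \<open>Captured tuples\<close>

lemma sorted_list_of_set_image: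
  fixes f :: "'a::linorder \<Rightarrow> 'b::linorder"
  assumes "finite A" "strict_mono_on A f"
  shows "sorted_list_of_set (f ` A) = map f (sorted_list_of_set A)"
proof (rule sorted_distinct_set_unique)
  have mono: "mono_on A f"
    using assms(2) by (rule strict_mono_on_imp_mono_on)
  show "sorted (map f (sorted_list_of_set A))"
    unfolding sorted_map
    by (rule sorted_wrt_mono_rel[OF _ sorted_sorted_list_of_set])
      (use mono assms(1) in \<open>auto simp: mono_on_def\<close>)
  show "distinct (map f (sorted_list_of_set A))"
    using strict_mono_on_imp_inj_on[OF assms(2)] assms(1) by (simp add: distinct_map)
qed (use assms(1) in auto)

lemma elt_singleton [simp]: "elt {x} 0 = x"
  by (simp add: elt_def)

lemma elt_mem: "finite D \<Longrightarrow> a < card D \<Longrightarrow> elt D a \<in> D"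
  unfolding elt_def by (metis length_sorted_list_of_set nth_mem set_sorted_list_of_set)

lemma elt_image: "finite D \<Longrightarrow> elt D ` {..<card D} = D"
  unfolding elt_def
  using nth_image[of "card D" "sorted_list_of_set D"] by (simp add: atLeast0LessThan)

lemma inj_on_elt: "inj_on (elt D) {..<card D}"
  unfolding elt_def inj_on_def
  by (simp add: nth_eq_iff_index_eq)

text \<open>The enumeration of \<open>D\<close> is that of \<open>R\<close> followed by that of
  \<open>D - R\<close>.\<close>

lemma elt_initial:
  assumes "finite D" "R \<subseteq> D" "set_less R (D - R)" "a < card D"
  shows "elt D a \<in> R \<longleftrightarrow> a < card R"
proof -
  have finR: "finite R" using assms(1,2) finite_subset by blast
  have "sorted_list_of_set D = sorted_list_of_set R @ sorted_list_of_set (D - R)"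
  proof (rule sorted_distinct_set_unique)
    show "sorted (sorted_list_of_set R @ sorted_list_of_set (D - R))"
      using assms(1,3) finR by (auto simp: sorted_append set_less_def less_imp_le)
  qed (use assms(1,2) finR in auto)
  then have eq: "elt D a = (if a < card R then elt R a else elt (D - R) (a - card R))"
    by (simp add: elt_def nth_append)
  show ?thesis
  proof (cases "a < card R")
    case True
    then show ?thesis using elt_mem[OF finR True] eq by simp
  next
    case False
    have "a - card R < card (D - R)"
      using False assms(4) card_Diff_subset[OF finR assms(2)] by linarith
    then have "elt D a \<in> D - R"
      using elt_mem[of "D - R"] assms(1) False eq by simp
    then show ?thesis using False by simp
  qed
qed

context scheme
begin

section \<open>Blocks, \<open>Delta\<close>, and tuples captured at a level\<close>

lemma decomposition_lev: "decomposition \<tau> \<F> (Suc k) F G R \<Longrightarrow> a < nn \<tau> (Suc k) \<Longrightarrow> G a \<in> lev k"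
  and decomposition_subset: "decomposition \<tau> \<F> k F G R \<Longrightarrow> a < nn \<tau> k \<Longrightarrow> G a \<subseteq> F"
  and decomposition_root_subset: "decomposition \<tau> \<F> k F G R \<Longrightarrow> a < nn \<tau> k \<Longrightarrow> R \<subseteq> G a"
  and decomposition_root_less:
    "decomposition \<tau> \<F> k F G R \<Longrightarrow> a < nn \<tau> k \<Longrightarrow> set_less R (G a - R)"
  and decomposition_Int:
    "decomposition \<tau> \<F> k F G R \<Longrightarrow> a < nn \<tau> k \<Longrightarrow> b < nn \<tau> k \<Longrightarrow> a \<noteq> b \<Longrightarrow> G a \<inter> G b = R"
  and decomposition_less:
    "decomposition \<tau> \<F> k F G R \<Longrightarrow> a < nn \<tau> k \<Longrightarrow> b < nn \<tau> k \<Longrightarrow> a < b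
      \<Longrightarrow> set_less (G a - R) (G b - R)"
  by (auto simp: decomposition_def root_tail_tail_def)

text \<open>Cofinality puts both points into one member, where distinct points have distinct
  positions; hence the minimum in \<open>Delta\<close> exists.\<close>

lemma Delta_norm:
  assumes "\<alpha> \<noteq> \<beta>"
  shows "nrm \<alpha> (Delta \<tau> \<F> \<alpha> \<beta>) \<noteq> nrm \<beta> (Delta \<tau> \<F> \<alpha> \<beta>)"
    and "j < Delta \<tau> \<F> \<alpha> \<beta> \<Longrightarrow> nrm \<alpha> j = nrm \<beta> j"
proof -
  obtain F where "F \<in> \<F>" "{\<alpha>, \<beta>} \<subseteq> F"
    using cs unfolding construction_scheme_def by (meson finite.emptyI finite.insertI)
  then obtain k where "F \<in> lev k" "\<alpha> \<in> F" "\<beta> \<in> F" using in_some_level by auto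
  then have "nrm \<alpha> k \<noteq> nrm \<beta> k" using norm_inject assms by metis
  then show "nrm \<alpha> (Delta \<tau> \<F> \<alpha> \<beta>) \<noteq> nrm \<beta> (Delta \<tau> \<F> \<alpha> \<beta>)"
    unfolding Delta_def by (rule LeastI)
  show "j < Delta \<tau> \<F> \<alpha> \<beta> \<Longrightarrow> nrm \<alpha> j = nrm \<beta> j"
    unfolding Delta_def using not_less_Least by blast
qed

lemma Delta_eqI:
  assumes "nrm \<alpha> k = nrm \<beta> k" "nrm \<alpha> (Suc k) \<noteq> nrm \<beta> (Suc k)"
  shows "Delta \<tau> \<F> \<alpha> \<beta> = Suc k"
  unfolding Delta_def
proof (rule Least_equality)
  fix j assume "nrm \<alpha> j \<noteq> nrm \<beta> j"
  then show "Suc k \<le> j"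
    using norm_eq_down[of j k] assms(1) by (metis not_less_eq_eq)
qed (fact assms(2))

text \<open>\<open>F\<close> gives the upper bound. For the lower one, the block of the larger point
  has level \<open>k\<close> and misses the other point.\<close>

lemma rho_blocks:
  assumes dec: "decomposition \<tau> \<F> (Suc k) F G R" and F: "F \<in> lev (Suc k)"
    and ab: "a < nn \<tau> (Suc k)" "b < nn \<tau> (Suc k)" "a \<noteq> b"
    and \<alpha>: "\<alpha> \<in> G a" "\<alpha> \<notin> R" and \<beta>: "\<beta> \<in> G b" "\<beta> \<notin> R"
  shows "\<rho> \<alpha> \<beta> = Suc k"
proof -
  have F': "\<alpha> \<in> F" "\<beta> \<in> F" using decomposition_subset[OF dec] ab \<alpha> \<beta> by auto
  have "\<alpha> \<notin> G b" "\<beta> \<notin> G a"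
    using decomposition_Int[OF dec ab] \<alpha> \<beta> by auto
  then show ?thesis
    using rho_le_iff[OF F F'(1), of \<beta>] rho_le_iff[OF F F'(2), of \<alpha>] F'
      rho_le_iff[OF decomposition_lev[OF dec ab(1)] \<alpha>(1), of \<beta>]
      rho_le_iff[OF decomposition_lev[OF dec ab(2)] \<beta>(1), of \<alpha>]
    by (metis le_SucE linear rho_commute)
qed

text \<open>Pointwise form of capturing singletons: for at least two distinct entries the root is
  empty, so the value -1 of \<open>Xi\<close> does not occur.\<close>

definition captured_tuple :: "nat \<Rightarrow> nat \<Rightarrow> (nat \<Rightarrow> omega1) \<Rightarrow> bool"
  where "captured_tuple l n t \<longleftrightarrow> (\<forall>i<n. Xi \<tau> \<F> (t i) l = int i) \<and>
    (\<forall>j<n. \<forall>i<j. t i < t j \<and> \<rho> (t i) (t j) = l \<and> Delta \<tau> \<F> (t i) (t j) = l)"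

lemma captured_family_singletons:
  assumes n: "2 \<le> n" and inj: "inj_on t {..<n}"
  shows "captured_family \<tau> \<F> l n (\<lambda>i. {t i}) \<longleftrightarrow> captured_tuple l n t"
proof
  assume "captured_family \<tau> \<F> l n (\<lambda>i. {t i})"
  then obtain d R where d: "\<forall>i<n. finite {t i} \<and> card {t i} = d"
    and rtt: "root_tail_tail n (\<lambda>i. {t i}) R"
    and Xi: "\<forall>i<n. \<forall>a<d. Xi \<tau> \<F> (elt {t i} a) l = (if a < card R then -1 else int i)"
    and rho: "\<forall>j<n. \<forall>i<j. \<forall>a. card R \<le> a \<and> a < d \<longrightarrow>
          \<rho> (elt {t i} a) (elt {t j} a) = l \<and> Delta \<tau> \<F> (elt {t i} a) (elt {t j} a) = l"
    unfolding captured_family_def by blast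
  have "d = 1" using d n by force
  have "t 0 \<noteq> t 1" using inj_onD[OF inj, of 0 1] n by auto
  moreover have "{t 0} \<inter> {t 1} = R"
    using rtt n unfolding root_tail_tail_def by simp
  ultimately have "R = {}" by auto
  have "t i < t j" if "j < n" "i < j" for i j
    using rtt that less_trans[OF that(2,1)] \<open>R = {}\<close>
    unfolding root_tail_tail_def set_less_def by simp
  then show "captured_tuple l n t"
    using Xi rho \<open>d = 1\<close> \<open>R = {}\<close> unfolding captured_tuple_def by simp
next
  assume t: "captured_tuple l n t"
  have "root_tail_tail n (\<lambda>i. {t i}) {}"
    using t inj unfolding captured_tuple_def root_tail_tail_def set_less_def inj_on_def by auto
  then show "captured_family \<tau> \<F> l n (\<lambda>i. {t i})"
    using t unfolding captured_family_def captured_tuple_def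
    by (intro exI[of _ 1] exI[of _ "{}"]) simp
qed

lemma captured_tuple_strict_mono: "captured_tuple l n t \<Longrightarrow> strict_mono_on {..<n} t"
  unfolding captured_tuple_def strict_mono_on_def by simp

lemma captured_tuple_inj: "captured_tuple l n t \<Longrightarrow> inj_on t {..<n}"
  by (rule strict_mono_on_imp_inj_on[OF captured_tuple_strict_mono])

lemma rho_set_captured_tuple:
  assumes "2 \<le> n" "captured_tuple l n t"
  shows "rho_set \<tau> \<F> (t ` {..<n}) = l"
  unfolding rho_set_def
proof (rule Max_eqI)
  have "{\<rho> \<alpha> \<beta> |\<alpha> \<beta>. \<alpha> \<in> t ` {..<n} \<and> \<beta> \<in> t ` {..<n}}
      = (\<lambda>(\<alpha>, \<beta>). \<rho> \<alpha> \<beta>) ` (t ` {..<n} \<times> t ` {..<n})" by auto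
  then show "finite {\<rho> \<alpha> \<beta> |\<alpha> \<beta>. \<alpha> \<in> t ` {..<n} \<and> \<beta> \<in> t ` {..<n}}" by simp
next
  fix y assume "y \<in> {\<rho> \<alpha> \<beta> |\<alpha> \<beta>. \<alpha> \<in> t ` {..<n} \<and> \<beta> \<in> t ` {..<n}}"
  then obtain i j where ij: "y = \<rho> (t i) (t j)" "i < n" "j < n" by auto
  consider "i < j" | "j < i" | "i = j" by linarith
  then show "y \<le> l"
    using assms(2) ij rho_commute[of "t i" "t j"]
    unfolding captured_tuple_def by cases (auto simp: rho_self)
next
  have "\<rho> (t 0) (t 1) = l" "t 0 \<in> t ` {..<n}" "t 1 \<in> t ` {..<n}"
    using assms unfolding captured_tuple_def by auto
  then show "l \<in> {\<rho> \<alpha> \<beta> |\<alpha> \<beta>. \<alpha> \<in> t ` {..<n} \<and> \<beta> \<in> t ` {..<n}}" by blast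
qed

text \<open>All pairs of distinct entries of a captured tuple have \<rho> equal to its level, so
  \<open>rho_set\<close> returns that level and \<open>pi_set\<close> collects the levels at which
  tuples from \<open>S\<close> are captured.\<close>

lemma mem_pi_set_iff:
  assumes n: "2 \<le> n"
  shows "l \<in> pi_set \<tau> \<F> n S \<longleftrightarrow> (\<exists>t. captured_tuple l n t \<and> t ` {..<n} \<subseteq> S)"
proof
  assume "l \<in> pi_set \<tau> \<F> n S"
  then obtain D l' where D: "l = rho_set \<tau> \<F> D" "D \<subseteq> S" "finite D" "card D = n"
    and "captured_set \<tau> \<F> l' D"
    unfolding pi_set_def by blast
  then have t: "captured_tuple l' n (elt D)"
    using captured_family_singletons[OF n] inj_on_elt unfolding captured_set_def by metis
  moreover have "elt D ` {..<n} = D" using elt_image D by blast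
  ultimately show "\<exists>t. captured_tuple l n t \<and> t ` {..<n} \<subseteq> S"
    using rho_set_captured_tuple[OF n t] D by metis
next
  assume "\<exists>t. captured_tuple l n t \<and> t ` {..<n} \<subseteq> S"
  then obtain t where t: "captured_tuple l n t" "t ` {..<n} \<subseteq> S" by blast
  define D where "D = t ` {..<n}"
  have card: "card D = n" using captured_tuple_inj[OF t(1)] by (simp add: D_def card_image)
  have "sorted_list_of_set D = map t [0..<n]"
    using sorted_list_of_set_image[OF _ captured_tuple_strict_mono[OF t(1)]]
    by (simp add: D_def lessThan_atLeast0)
  then have elt: "elt D i = t i" if "i < n" for i using that by (simp add: elt_def)
  have "captured_tuple l n (elt D)"
    using t(1) unfolding captured_tuple_def by (simp add: elt)
  then have "captured_set \<tau> \<F> l D"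
    using captured_family_singletons[OF n] inj_on_elt[of D] card
    by (simp add: captured_set_def D_def)
  then show "l \<in> pi_set \<tau> \<F> n S"
    using rho_set_captured_tuple[OF n t(1)] t(2) card unfolding pi_set_def D_def by auto
qed

lemma captured_tuple_frame:
  assumes n: "2 \<le> n" and t: "captured_tuple l n t"
  obtains k F G R where "l = Suc k" "F \<in> lev l" "decomposition \<tau> \<F> l F G R"
    "\<And>i. i < n \<Longrightarrow> i < nn \<tau> l" "\<And>i. i < n \<Longrightarrow> t i \<in> G i" "\<And>i. i < n \<Longrightarrow> t i \<notin> R"
proof -
  \<comment> \<open>At level 0 the function \<open>Xi\<close> is constantly 0, so the value 1
    excludes \<open>l = 0\<close>.\<close>
  have "Xi \<tau> \<F> (t 1) l = 1" using n t unfolding captured_tuple_def by simp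
  then have "l \<noteq> 0" unfolding Xi_def by (metis zero_neq_one)
  then obtain k where k: "l = Suc k" using not0_implies_Suc by blast
  \<comment> \<open>A member around the largest entry contains the smaller ones, since they are at
    \<rho>-distance \<open>l\<close> from it.\<close>
  obtain F where F: "F \<in> lev (Suc k)" "t (n - 1) \<in> F" using level_cover by blast
  obtain G R where dec: "decomposition \<tau> \<F> (Suc k) F G R"
    using obtain_decomposition F(1) by blast
  have tF: "t i \<in> F" if "i < n" for i
  proof (cases "i = n - 1")
    case False
    then have "i < n - 1" "n - 1 < n" using that by auto
    then have "t i < t (n - 1)" "\<rho> (t (n - 1)) (t i) = l"
      using t unfolding captured_tuple_def rho_commute[of "t (n - 1)"] by blast+
    then show ?thesis using rho_le_iff[OF F, of "t i"] k by simp
  qed (use F in simp)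
  have "i < nn \<tau> l \<and> t i \<in> G i \<and> t i \<notin> R" if i: "i < n" for i
  proof -
    obtain b where b: "b < nn \<tau> (Suc k)" "t i \<in> G b"
      using tF[OF i] dec unfolding decomposition_def by blast
    have "Xi \<tau> \<F> (t i) (Suc k) = int i"
      using t i k unfolding captured_tuple_def by simp
    then have "b = i" "t i \<notin> R"
      using Xi_eq[OF dec F(1) b] by (auto split: if_splits)
    then show ?thesis using b k by simp
  qed
  then show ?thesis using that[of k F G R] k F(1) dec by blast
qed


section \<open>Transfer from a captured tuple to finite sets near its entries\<close>

lemma captured_tuple_norm_eq:
  assumes t: "captured_tuple l n t" and "i < n" "j < n" "k < l"
  shows "nrm (t i) k = nrm (t j) k"
proof -
  have "nrm (t i) k = nrm (t j) k" if "i < j" "j < n" for i j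
  proof -
    have "t i < t j" "Delta \<tau> \<F> (t i) (t j) = l"
      using t that unfolding captured_tuple_def by auto
    then show ?thesis using Delta_norm(2)[of "t i" "t j" k] assms(4) by simp
  qed
  then show ?thesis using assms(2,3) by (metis linorder_neqE_nat)
qed

text \<open>At level \<open>l\<close> the norms differ, while equality of norms is inherited by all
  lower levels.\<close>

lemma captured_tuple_less_level:
  assumes "2 \<le> n" and t: "captured_tuple l n t" and eq: "nrm (t 0) k = nrm (t 1) k"
  shows "k < l"
proof (rule ccontr)
  assume "\<not> k < l"
  have "t 0 < t 1" "Delta \<tau> \<F> (t 0) (t 1) = l"
    using t assms(1) unfolding captured_tuple_def by auto
  then have "nrm (t 0) l \<noteq> nrm (t 1) l"
    using Delta_norm(1)[of "t 0" "t 1"] by simp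
  then show False using norm_eq_down[OF _ eq] \<open>\<not> k < l\<close> by simp
qed

text \<open>Such a \<open>D\<close> lies inside every member of level \<open>k\<close> containing
  \<open>s\<close>, so its points are told apart by their norms at \<open>k\<close>.\<close>

definition near :: "nat \<Rightarrow> omega1 \<Rightarrow> omega1 set \<Rightarrow> bool"
  where "near k s D \<longleftrightarrow> finite D \<and> (\<forall>\<xi>\<in>D. \<xi> \<le> s \<and> \<rho> s \<xi> \<le> k)"

lemma near_norm_strict_mono:
  assumes "near k s D"
  shows "strict_mono_on D (\<lambda>\<xi>. nrm \<xi> k)"
proof (rule strict_mono_onI)
  fix \<alpha> \<beta> assume D: "\<alpha> \<in> D" "\<beta> \<in> D" and less: "\<alpha> < \<beta>"
  obtain F where F: "F \<in> lev k" "s \<in> F" using level_cover by blast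
  have "\<xi> \<in> F" if "\<xi> \<in> D" for \<xi>
    using assms that rho_le_iff[OF F, of \<xi>] unfolding near_def by simp
  then show "nrm \<alpha> k < nrm \<beta> k"
    using norm_strict_mono[OF F(1)] D less by simp
qed

lemma near_norm_elt:
  assumes "near k s D" "a < card D"
  shows "nrm (elt D a) k = sorted_list_of_set ((\<lambda>\<xi>. nrm \<xi> k) ` D) ! a"
  using sorted_list_of_set_image[OF _ near_norm_strict_mono[OF assms(1)]] assms
  unfolding near_def elt_def by simp

text \<open>By \<open>norm_eq_transfer\<close> the equality of norms rises from \<open>j\<close> to
  \<open>k\<close>, so \<xi> and \<xi>' have the same position in their blocks. Position decides
  root membership and identifies root points; outside the root, different blocks separate the two
  points exactly at \<open>Suc k\<close>.\<close>

lemma block_transfer: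
  assumes dec: "decomposition \<tau> \<F> (Suc k) F G R" and F: "F \<in> lev (Suc k)"
    and ab: "a < nn \<tau> (Suc k)" "b < nn \<tau> (Suc k)" and t: "t \<in> G a" "t' \<in> G b"
    and t_eq: "nrm t k = nrm t' k"
    and le: "\<xi> \<le> t" "\<xi>' \<le> t'" and rho: "\<rho> t \<xi> \<le> j" "\<rho> t' \<xi>' \<le> j" and j: "j \<le> k"
    and eq: "nrm \<xi> j = nrm \<xi>' j"
  shows "\<xi> \<in> G a" "\<xi>' \<in> G b" "nrm \<xi> k = nrm \<xi>' k" "\<xi> \<in> R \<longleftrightarrow> \<xi>' \<in> R"
    and "\<xi> \<in> R \<Longrightarrow> \<xi> = \<xi>'"
    and "\<xi> \<notin> R \<Longrightarrow> a \<noteq> b \<Longrightarrow> \<rho> \<xi> \<xi>' = Suc k \<and> Delta \<tau> \<F> \<xi> \<xi>' = Suc k"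
proof -
  show G: "\<xi> \<in> G a" "\<xi>' \<in> G b"
    using rho_le_iff[OF decomposition_lev[OF dec ab(1)] t(1) le(1)]
      rho_le_iff[OF decomposition_lev[OF dec ab(2)] t(2) le(2)] rho j by auto
  show nk: "nrm \<xi> k = nrm \<xi>' k"
    by (rule norm_eq_transfer[OF le rho eq j t_eq])
  show R: "\<xi> \<in> R \<longleftrightarrow> \<xi>' \<in> R"
    using norm_Suc(1)[OF dec F ab(1) G(1)] norm_Suc(1)[OF dec F ab(2) G(2)] nk by simp
  show "\<xi> = \<xi>'" if "\<xi> \<in> R"
    using norm_inject[OF decomposition_lev[OF dec ab(1)] G(1) _ nk]
      decomposition_root_subset[OF dec ab(1)] R that by auto
  assume \<xi>: "\<xi> \<notin> R" and neq: "a \<noteq> b"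
  then have \<xi>': "\<xi>' \<notin> R" using R by simp
  have "\<xi> \<noteq> \<xi>'" using decomposition_Int[OF dec ab neq] G \<xi> by auto
  then have "nrm \<xi> (Suc k) \<noteq> nrm \<xi>' (Suc k)"
    using norm_inject[OF F] decomposition_subset[OF dec] ab G by blast
  then show "\<rho> \<xi> \<xi>' = Suc k \<and> Delta \<tau> \<F> \<xi> \<xi>' = Suc k"
    using rho_blocks[OF dec F ab neq G(1) \<xi> G(2) \<xi>'] Delta_eqI[OF nk] by simp
qed

text \<open>Within the \<open>k\<close>-closure of \<open>t i\<close> an element is determined by its norm at \<open>k\<close>, and elements with the
  same norm at \<open>k\<close> keep equal norms at all levels below \<open>l\<close>, because the \<open>t i\<close> do.\<close>

lemma captured_family_near:
  assumes n: "2 \<le> n" and t: "captured_tuple l n t"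
    and c: "\<And>i. i < n \<Longrightarrow> nrm (t i) k = c"
    and near: "\<And>i. i < n \<Longrightarrow> near k (t i) (D i)"
    and C: "\<And>i. i < n \<Longrightarrow> (\<lambda>\<xi>. nrm \<xi> k) ` D i = C"
  shows "captured_family \<tau> \<F> l n D"
proof -
  obtain k' F G R where l: "l = Suc k'" and F: "F \<in> lev (Suc k')"
    and dec: "decomposition \<tau> \<F> (Suc k') F G R" and nn: "\<And>i. i < n \<Longrightarrow> i < nn \<tau> (Suc k')"
    and tG: "\<And>i. i < n \<Longrightarrow> t i \<in> G i"
    using captured_tuple_frame[OF n t] by metis
  have "k < l" using captured_tuple_less_level[OF n t] c n by simp
  then have k: "k \<le> k'" using l by simp
  have teq: "nrm (t i) k' = nrm (t j) k'" if "i < n" "j < n" for i j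
    using captured_tuple_norm_eq[OF t that] l by simp
  have D_le: "\<xi> \<le> t i" "\<rho> (t i) \<xi> \<le> k" if "i < n" "\<xi> \<in> D i" for i \<xi>
    using near that unfolding near_def by auto
  have tr: "\<xi> \<in> G i" "\<xi>' \<in> G j" "\<xi> \<in> R \<longleftrightarrow> \<xi>' \<in> R" "\<xi> \<in> R \<Longrightarrow> \<xi> = \<xi>'"
    "\<xi> \<notin> R \<Longrightarrow> i \<noteq> j \<Longrightarrow> \<rho> \<xi> \<xi>' = l \<and> Delta \<tau> \<F> \<xi> \<xi>' = l"
    if "i < n" "j < n" "\<xi> \<in> D i" "\<xi>' \<in> D j" "nrm \<xi> k = nrm \<xi>' k" for i j \<xi> \<xi>'
    unfolding l
    by (fact block_transfer[OF dec F nn[OF that(1)] nn[OF that(2)] tG[OF that(1)] tG[OF that(2)]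
        teq[OF that(1,2)] D_le(1)[OF that(1,3)] D_le(1)[OF that(2,4)]
        D_le(2)[OF that(1,3)] D_le(2)[OF that(2,4)] k that(5)])+
  define R' where "R' = D 0 \<inter> R"
  have R': "D i \<inter> R = R'" if i: "i < n" for i
  proof -
    \<comment> \<open>The sets share their norm values \<open>C\<close>, so a root point of
      \<open>D i\<close> has a partner in \<open>D j\<close> of equal norm, and for root points the
      partner is the point itself.\<close>
    have "D i \<inter> R \<subseteq> D j" if j: "j < n" and i: "i < n" for i j
    proof
      fix \<xi> assume \<xi>: "\<xi> \<in> D i \<inter> R"
      then have "nrm \<xi> k \<in> (\<lambda>\<xi>. nrm \<xi> k) ` D j" using C i j by auto
      then obtain \<xi>' where \<xi>': "\<xi>' \<in> D j" "nrm \<xi> k = nrm \<xi>' k" by blast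
      then show "\<xi> \<in> D j" using tr(4)[OF i j _ \<xi>'] \<xi> by auto
    qed
    from this[of 0 i] this[of i 0] show ?thesis using i n unfolding R'_def by auto
  qed
  have fin: "finite (D i)" and card: "card (D i) = card C" if "i < n" for i
    using near[OF that] C[OF that] card_image[OF strict_mono_on_imp_inj_on[OF near_norm_strict_mono]]
    unfolding near_def by auto
  have DG: "D i \<subseteq> G i" if "i < n" for i
    using tr(1)[OF that that] by blast
  have D_R: "D i - R' = D i - R" if "i < n" for i using R'[OF that] by auto
  have rtt: "root_tail_tail n D R'"
    unfolding root_tail_tail_def
  proof (intro conjI allI impI)
    fix i assume i: "i < n"
    show "R' \<subseteq> D i" using R'[OF i] by blast
    show "set_less R' (D i - R')"
      using decomposition_root_less[OF dec nn[OF i]] DG[OF i] D_R[OF i] R'[OF i]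
      unfolding set_less_def by auto
  next
    fix i j assume ij: "i < n" "j < n" "i \<noteq> j"
    have "D i \<inter> D j \<subseteq> R"
      using decomposition_Int[OF dec nn[OF ij(1)] nn[OF ij(2)] ij(3)] DG ij by blast
    then show "D i \<inter> D j = R'" using R'[OF ij(1)] R'[OF ij(2)] by blast
  next
    fix i j assume ij: "i < n" "j < n" "i < j"
    show "set_less (D i - R') (D j - R')"
      using decomposition_less[OF dec nn[OF ij(1)] nn[OF ij(2)] ij(3)] DG[OF ij(1)] DG[OF ij(2)]
        D_R[OF ij(1)] D_R[OF ij(2)]
      unfolding set_less_def by auto
  qed
  have elt_D: "elt (D i) a \<in> D i" if "i < n" "a < card C" for i a
    using elt_mem fin card that by simp
  have elt_R: "elt (D i) a \<in> R \<longleftrightarrow> a < card R'" if "i < n" "a < card C" for i a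
  proof -
    have "elt (D i) a \<in> R' \<longleftrightarrow> a < card R'"
      using elt_initial[of "D i" R' a] rtt fin card that unfolding root_tail_tail_def by simp
    then show ?thesis using elt_D[OF that] R'[OF that(1)] by auto
  qed
  \<comment> \<open>The norm at \<open>k\<close> is strictly increasing on each \<open>D i\<close>
    with the common range \<open>C\<close>, so each \<open>a\<close>-th element has the
    \<open>a\<close>-th value of \<open>C\<close>.\<close>
  have elt_norm: "nrm (elt (D i) a) k = nrm (elt (D j) a) k"
    if "i < n" "j < n" "a < card C" for i j a
    using near_norm_elt[OF near] C card that by simp
  have Xi: "Xi \<tau> \<F> (elt (D i) a) l = (if a < card R' then -1 else int i)"
    if "i < n" "a < card C" for i a
    using Xi_eq[OF dec F nn[OF that(1)]] elt_D[OF that] DG[OF that(1)] elt_R[OF that] l by auto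
  have rho: "\<rho> (elt (D i) a) (elt (D j) a) = l \<and> Delta \<tau> \<F> (elt (D i) a) (elt (D j) a) = l"
    if "j < n" "i < j" "card R' \<le> a" "a < card C" for i j a
  proof -
    have i: "i < n" using that by simp
    show ?thesis
      using tr(5)[OF i that(1) elt_D[OF i that(4)] elt_D[OF that(1,4)] elt_norm[OF i that(1,4)]]
        elt_R[OF i that(4)] that by simp
  qed
  show ?thesis
    unfolding captured_family_def
    using fin card rtt Xi rho by (intro exI[of _ "card C"] exI[of _ R']) simp
qed

lemma pi_set_mono: "S \<subseteq> T \<Longrightarrow> pi_set \<tau> \<F> n S \<subseteq> pi_set \<tau> \<F> n T"
  unfolding pi_set_def by blast

text \<open>Points outside the root in different blocks are at \<rho>-distance \<open>l\<close>, and
  a root point of one \<open>D i\<close> belongs to all of them. So a tuple captured at another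
  level cannot be spread over several \<open>D i\<close>.\<close>

lemma pi_set_Union_near:
  assumes n: "2 \<le> n" and t: "captured_tuple l n t"
    and c: "\<And>i. i < n \<Longrightarrow> nrm (t i) k = c"
    and near: "\<And>i. i < n \<Longrightarrow> near k (t i) (D i)"
    and C: "\<And>i. i < n \<Longrightarrow> (\<lambda>\<xi>. nrm \<xi> k) ` D i = C"
  shows "pi_set \<tau> \<F> n (\<Union>i<n. D i) \<subseteq> insert l (\<Union>i<n. pi_set \<tau> \<F> n (D i))"
proof
  fix l' assume "l' \<in> pi_set \<tau> \<F> n (\<Union>i<n. D i)"
  then obtain x where x: "captured_tuple l' n x" "x ` {..<n} \<subseteq> (\<Union>i<n. D i)"
    unfolding mem_pi_set_iff[OF n] by blast
  obtain k' F G R where l: "l = Suc k'" and F: "F \<in> lev (Suc k')"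
    and dec: "decomposition \<tau> \<F> (Suc k') F G R" and nn: "\<And>i. i < n \<Longrightarrow> i < nn \<tau> (Suc k')"
    and tG: "\<And>i. i < n \<Longrightarrow> t i \<in> G i"
    using captured_tuple_frame[OF n t] by metis
  have "k < l" using captured_tuple_less_level[OF n t] c n by simp
  then have k: "k \<le> k'" using l by simp
  have D_le: "\<xi> \<le> t i" "\<rho> (t i) \<xi> \<le> k" if "i < n" "\<xi> \<in> D i" for i \<xi>
    using near that unfolding near_def by auto
  have DG: "\<xi> \<in> G i" if "i < n" "\<xi> \<in> D i" for i \<xi>
    using rho_le_iff[OF decomposition_lev[OF dec nn[OF that(1)]] tG[OF that(1)] D_le(1)[OF that]]
      le_trans[OF D_le(2)[OF that] k] by simp
  have root: "\<xi> \<in> D j" if "i < n" "j < n" "\<xi> \<in> D i" "\<xi> \<in> R" for i j \<xi>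
  proof -
    have "nrm \<xi> k \<in> (\<lambda>\<xi>. nrm \<xi> k) ` D j" using C that by auto
    then obtain \<xi>' where \<xi>': "\<xi>' \<in> D j" "nrm \<xi> k = nrm \<xi>' k" by blast
    have "nrm (t i) k' = nrm (t j) k'"
      using captured_tuple_norm_eq[OF t that(1,2)] l by simp
    then show ?thesis
      using block_transfer(5)[OF dec F nn[OF that(1)] nn[OF that(2)] tG[OF that(1)] tG[OF that(2)]
          _ D_le(1)[OF that(1,3)] D_le(1)[OF that(2) \<xi>'(1)]
          D_le(2)[OF that(1,3)] D_le(2)[OF that(2) \<xi>'(1)] k \<xi>'(2) that(4)] \<xi>'(1) by simp
  qed
  have x_D: "\<exists>i<n. x a \<in> D i" if "a < n" for a
    using x(2) that by auto
  have x_F: "x a \<in> F" if "a < n" for a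
    using x_D[OF that] DG decomposition_subset[OF dec nn] by blast
  have rho_x: "\<rho> (x a) (x b) = l'" if "a < n" "b < n" "a \<noteq> b" for a b
    using x(1) that rho_commute[of "x a" "x b"] unfolding captured_tuple_def
    by (metis linorder_neqE_nat)
  show "l' \<in> insert l (\<Union>i<n. pi_set \<tau> \<F> n (D i))"
  proof (cases "l' = l")
    case False
    have "\<exists>i<n. \<forall>a<n. x a \<in> D i"
    proof (cases "\<forall>a<n. x a \<in> R")
      case True
      have n0: "0 < n" using n by simp
      have "x a \<in> D 0" if a: "a < n" for a
      proof -
        obtain i where i: "i < n" "x a \<in> D i" using x_D[OF a] by blast
        show ?thesis using root[OF i(1) n0 i(2)] True a by simp
      qed
      then show ?thesis using n0 by blast
    next
      case False
      then obtain a where a: "a < n" "x a \<notin> R" by blast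
      obtain i where i: "i < n" "x a \<in> D i" using x_D[OF a(1)] by blast
      \<comment> \<open>The entry \<open>x a\<close> outside the root fixes \<open>i\<close>. An
        entry missing from \<open>D i\<close> would be at \<rho>-distance \<open>l\<close> from
        \<open>x a\<close>, whereas distinct entries are at distance \<open>l'\<close>.\<close>
      have "x b \<in> D i" if b: "b < n" for b
      proof (rule ccontr)
        assume nb: "x b \<notin> D i"
        obtain j where j: "j < n" "x b \<in> D j" using x_D[OF b] by blast
        have "x b \<notin> R" using root[OF j(1) i(1) j(2)] nb by blast
        moreover have "i \<noteq> j" "a \<noteq> b" using nb j i by auto
        ultimately have "\<rho> (x a) (x b) = l"
          using rho_blocks[OF dec F nn[OF i(1)] nn[OF j(1)]] DG[OF i] DG[OF j] a l by simp
        then show False using rho_x[OF a(1) b \<open>a \<noteq> b\<close>] \<open>l' \<noteq> l\<close> by simp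
      qed
      then show ?thesis using i by blast
    qed
    then obtain i where "i < n" "x ` {..<n} \<subseteq> D i" by auto
    then have "l' \<in> pi_set \<tau> \<F> n (D i)"
      unfolding mem_pi_set_iff[OF n] using x(1) by blast
    then show ?thesis using \<open>i < n\<close> by blast
  qed simp
qed

end

section \<open>Uncountable sets of ordinals and the pigeonhole argument\<close>

lemma uncountable_omega1_unbounded:
  assumes "uncountable (S :: omega1 set)"
  shows "\<exists>s\<in>S. \<beta> < s"
proof (rule ccontr)
  assume "\<not> ?thesis"
  then have "S \<subseteq> insert \<beta> {..<\<beta>}" by force
  moreover have "countable (insert \<beta> {..<\<beta>})"
    by (simp add: countable_lessThan_omega1)
  ultimately show False
    using assms countable_subset by metis
qed

lemma unbounded_omega1_uncountable:
  assumes "\<And>\<beta> :: omega1. \<exists>s\<in>S. \<beta> < s"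
  shows "uncountable S"
proof
  assume "countable S"
  then have "countable (\<Union>s\<in>S. {..<s})"
    using countable_lessThan_omega1 by (intro countable_UN) auto
  moreover have "(\<Union>s\<in>S. {..<s}) = UNIV" using assms by auto
  ultimately show False using uncountable_omega1 by simp
qed

lemma uncountable_fibre:
  assumes "uncountable T" "countable (f ` T)"
  shows "\<exists>y. uncountable {x \<in> T. f x = y}"
proof (rule ccontr)
  assume "\<not> ?thesis"
  then have "countable (\<Union>y\<in>f ` T. {x \<in> T. f x = y})"
    using assms(2) by (intro countable_UN) auto
  moreover have "(\<Union>y\<in>f ` T. {x \<in> T. f x = y}) = T" by auto
  ultimately show False using assms(1) by simp
qed

lemma finite_pi_set: "finite S \<Longrightarrow> finite (pi_set \<tau> \<F> n S)"
  by (rule finite_subset[of _ "rho_set \<tau> \<F> ` Pow S"]) (auto simp: pi_set_def)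

text \<open>Each \<open>D\<close> in \<open>X\<close> carries a finite set \<open>p D\<close>, later
  a forcing condition. Place an ordinal of \<open>S\<close> above \<open>D\<close> and
  \<open>p D\<close>, keep one \<open>D\<close> per ordinal, and make all norm data equal by
  pigeonhole; a tuple captured in \<open>T\<close> then captures the chosen \<open>D\<close> and
  controls the union of their \<open>p D\<close>.\<close>

lemma (in scheme) uncountable_family_refine:
  assumes n: "2 \<le> n" and S: "uncountable S" and X: "uncountable X"
    and fin: "\<And>D. D \<in> X \<Longrightarrow> finite D" and finp: "\<And>D. D \<in> X \<Longrightarrow> finite (p D)"
  obtains T Q where "T \<subseteq> S" "uncountable T" "finite Q"
    "\<And>l. l \<in> pi_set \<tau> \<F> n T \<Longrightarrow> N < l \<and> (\<exists>D. inj_on D {..<n} \<and> D ` {..<n} \<subseteq> X \<and>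
      captured_family \<tau> \<F> l n D \<and> (\<forall>i<n. pi_set \<tau> \<F> n (p (D i)) = Q) \<and>
      pi_set \<tau> \<F> n (\<Union>i<n. p (D i)) \<subseteq> insert l Q)"
proof -
  define E where "E D = D \<union> p D" for D
  define top where "top D = (LEAST s. s \<in> S \<and> E D \<subseteq> {..<s})" for D
  have finE: "finite (E D)" if "D \<in> X" for D
    using fin[OF that] finp[OF that] by (simp add: E_def)
  have top: "top D \<in> S" "E D \<subseteq> {..<top D}" if D: "D \<in> X" for D
  proof -
    \<comment> \<open>Inserting \<open>undefined\<close> merely keeps the argument of
      \<open>Max\<close> nonempty.\<close>
    obtain s where "s \<in> S" "Max (insert undefined (E D)) < s"
      using uncountable_omega1_unbounded[OF S] by blast
    then have "\<exists>s. s \<in> S \<and> E D \<subseteq> {..<s}"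
      using finE[OF D] by (intro exI[of _ s]) auto
    then have "top D \<in> S \<and> E D \<subseteq> {..<top D}"
      unfolding top_def by (rule LeastI_ex)
    then show "top D \<in> S" "E D \<subseteq> {..<top D}" by auto
  qed
  \<comment> \<open>\<open>top\<close> is countable-to-one.\<close>
  have "uncountable (top ` X)"
  proof
    assume "countable (top ` X)"
    then obtain s where s: "uncountable {D \<in> X. top D = s}"
      using uncountable_fibre[OF X] by blast
    have "{D \<in> X. top D = s} \<subseteq> {D. finite D \<and> D \<subseteq> {..<s}}"
      using top(2) fin unfolding E_def by blast
    then show False
      using s countable_Collect_finite_subset[OF countable_lessThan_omega1] countable_subset by blast
  qed
  define d where "d s = inv_into X top s" for s
  \<comment> \<open>At this level all of \<open>E (d s)\<close> is near \<open>s\<close>. Inserting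
    \<open>N\<close> makes captured levels exceed \<open>N\<close>, since they exceed the common
    value of \<open>k\<close>.\<close>
  define k where "k s = Max (insert N (\<rho> s ` E (d s)))" for s
  \<comment> \<open>Finite sets of naturals are stored as sorted lists, so that \<open>data\<close>
    takes values in a countable type and still determines the sets.\<close>
  define data where "data s = (k s, nrm s (k s), sorted_list_of_set ((\<lambda>\<xi>. nrm \<xi> (k s)) ` d s),
    sorted_list_of_set ((\<lambda>\<xi>. nrm \<xi> (k s)) ` p (d s)),
    sorted_list_of_set (pi_set \<tau> \<F> n (p (d s))))" for s
  have d: "d s \<in> X" "top (d s) = s" if "s \<in> top ` X" for s
    using that unfolding d_def by (simp_all add: inv_into_into f_inv_into_f)
  have inj_d: "inj_on d (top ` X)"
    using d(2) by (metis inj_onI)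
  obtain y where y: "uncountable {s \<in> top ` X. data s = y}"
    using uncountable_fibre[OF \<open>uncountable (top ` X)\<close>, of data] by blast
  define T where "T = {s \<in> top ` X. data s = y}"
  have T: "s \<in> top ` X" "data s = y" if "s \<in> T" for s using that unfolding T_def by auto
  have "T \<noteq> {}" using y unfolding T_def by (metis countable_empty)
  then obtain s0 where s0: "s0 \<in> T" by blast
  have k: "k s = k s0" and nk: "nrm s (k s0) = nrm s0 (k s0)"
    and data_d: "(\<lambda>\<xi>. nrm \<xi> (k s0)) ` d s = (\<lambda>\<xi>. nrm \<xi> (k s0)) ` d s0"
    and data_p: "(\<lambda>\<xi>. nrm \<xi> (k s0)) ` p (d s) = (\<lambda>\<xi>. nrm \<xi> (k s0)) ` p (d s0)"
    and data_pi: "pi_set \<tau> \<F> n (p (d s)) = pi_set \<tau> \<F> n (p (d s0))" if s: "s \<in> T" for s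
  proof -
    have eq: "data s = data s0" using T(2)[OF s] T(2)[OF s0] by simp
    then show 1: "k s = k s0" by (simp add: data_def)
    show "nrm s (k s0) = nrm s0 (k s0)" using eq 1 by (simp add: data_def)
    have "d s \<in> X" "d s0 \<in> X" using d(1) T(1) s s0 by auto
    then have *: "finite (d s)" "finite (d s0)" "finite (p (d s))" "finite (p (d s0))"
      using fin finp by auto
    show "(\<lambda>\<xi>. nrm \<xi> (k s0)) ` d s = (\<lambda>\<xi>. nrm \<xi> (k s0)) ` d s0"
      using eq 1 * by (intro sorted_list_of_set_inject) (simp_all add: data_def)
    show "(\<lambda>\<xi>. nrm \<xi> (k s0)) ` p (d s) = (\<lambda>\<xi>. nrm \<xi> (k s0)) ` p (d s0)"
      using eq 1 * by (intro sorted_list_of_set_inject) (simp_all add: data_def)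
    show "pi_set \<tau> \<F> n (p (d s)) = pi_set \<tau> \<F> n (p (d s0))"
      using eq 1 * by (intro sorted_list_of_set_inject) (simp_all add: data_def finite_pi_set)
  qed
  have nearE: "near (k s0) s (E (d s))" if s: "s \<in> T" for s
  proof -
    have dX: "d s \<in> X" and ts: "top (d s) = s" using d T(1) s by auto
    have "\<rho> s \<xi> \<le> k s" if "\<xi> \<in> E (d s)" for \<xi>
      unfolding k_def using finE[OF dX] that by (intro Max_ge) auto
    moreover have "\<xi> \<le> s" if "\<xi> \<in> E (d s)" for \<xi>
      using top(2)[OF dX] that ts by auto
    ultimately show ?thesis using finE[OF dX] k[OF s] unfolding near_def by simp
  qed
  have near_d: "near (k s0) s (d s)" and near_p: "near (k s0) s (p (d s))" if s: "s \<in> T" for s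
    using nearE[OF s] unfolding near_def E_def by auto
  have main: "N < l \<and> (\<exists>D. inj_on D {..<n} \<and> D ` {..<n} \<subseteq> X \<and>
      captured_family \<tau> \<F> l n D \<and> (\<forall>i<n. pi_set \<tau> \<F> n (p (D i)) = pi_set \<tau> \<F> n (p (d s0))) \<and>
      pi_set \<tau> \<F> n (\<Union>i<n. p (D i)) \<subseteq> insert l (pi_set \<tau> \<F> n (p (d s0))))"
    if l: "l \<in> pi_set \<tau> \<F> n T" for l
  proof -
    obtain t where t: "captured_tuple l n t" "t ` {..<n} \<subseteq> T"
      using l unfolding mem_pi_set_iff[OF n] by blast
    have tT: "t i \<in> T" if "i < n" for i using t(2) that by auto
    have "nrm (t 0) (k s0) = nrm (t 1) (k s0)"
      using nk[OF tT, of 0] nk[OF tT, of 1] n by simp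
    then have "k s0 < l" by (rule captured_tuple_less_level[OF n t(1)])
    moreover have "N \<le> k s0"
      using finE[of "d s0"] d(1) T(1)[OF s0] unfolding k_def by (intro Max_ge) auto
    moreover have "inj_on (d \<circ> t) {..<n}"
      using captured_tuple_inj[OF t(1)] inj_d t(2) T(1)
      by (intro comp_inj_on) (auto intro: inj_on_subset)
    moreover have "(d \<circ> t) ` {..<n} \<subseteq> X" using d(1) T(1) tT by auto
    moreover have "captured_family \<tau> \<F> l n (d \<circ> t)"
      by (rule captured_family_near[OF n t(1), of "k s0" "nrm s0 (k s0)"])
        (use nk tT near_d data_d in auto)
    moreover have pi: "pi_set \<tau> \<F> n (p ((d \<circ> t) i)) = pi_set \<tau> \<F> n (p (d s0))" if "i < n" for i
      using data_pi[OF tT[OF that]] by simp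
    moreover have "pi_set \<tau> \<F> n (\<Union>i<n. p ((d \<circ> t) i))
        \<subseteq> insert l (\<Union>i<n. pi_set \<tau> \<F> n (p ((d \<circ> t) i)))"
      by (rule pi_set_Union_near[OF n t(1), of "k s0" "nrm s0 (k s0)"])
        (use nk tT near_p data_p in auto)
    then have "pi_set \<tau> \<F> n (\<Union>i<n. p ((d \<circ> t) i)) \<subseteq> insert l (pi_set \<tau> \<F> n (p (d s0)))"
      by (rule order_trans) (use pi in blast)
    ultimately show ?thesis by (intro conjI exI[of _ "d \<circ> t"]) simp_all
  qed
  have "T \<subseteq> S" using top(1) T(1) by blast
  moreover have "finite (pi_set \<tau> \<F> n (p (d s0)))"
    by (rule finite_pi_set[OF finp[OF d(1)[OF T(1)[OF s0]]]])
  ultimately show ?thesis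
    using y main by (intro that[of T "pi_set \<tau> \<F> n (p (d s0))"]) (simp_all only: T_def not_False_eq_True)
qed

section \<open>Forcing that a scheme is capturing\<close>

text \<open>Implication is a negated conjunction, so the consequent need only be forced by some
  extension of each \<open>q\<close> below \<open>p\<close> that forces the antecedent.\<close>

lemma fm_impI:
  "(\<And>q. (q, p) \<in> P \<Longrightarrow> \<phi> q \<Longrightarrow> \<exists>s. (s, q) \<in> P \<and> \<psi> s) \<Longrightarrow> fm_imp P \<phi> \<psi> p"
  unfolding fm_imp_def fm_not_def fm_and_def by blast

lemma fm_impD:
  "fm_imp P \<phi> \<psi> p \<Longrightarrow> (q, p) \<in> P \<Longrightarrow> \<phi> q \<Longrightarrow> \<exists>s. (s, q) \<in> P \<and> \<psi> s"
  unfolding fm_imp_def fm_not_def fm_and_def by blast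

lemma fm_exI:
  "(\<And>q. (q, p) \<in> P \<Longrightarrow> \<exists>s x. (s, q) \<in> P \<and> \<Phi> x s) \<Longrightarrow> fm_ex P \<Phi> p"
  unfolding fm_ex_def fm_not_def fm_all_def by blast

lemma fm_allI: "(\<And>x. \<Phi> x p) \<Longrightarrow> fm_all \<Phi> p"
  unfolding fm_all_def by blast

lemma fm_mem_mono:
  assumes "trans P" "fm_mem P x N p" "(q, p) \<in> P"
  shows "fm_mem P x N q"
  using assms unfolding fm_mem_def by (blast dest: transD)

lemma poset_refl: "poset P \<Longrightarrow> p \<in> Field P \<Longrightarrow> (p, p) \<in> P"
  and poset_trans: "poset P \<Longrightarrow> trans P"
  unfolding poset_def order_on_defs by (auto dest: refl_onD)

lemma poset_ex_self: "poset P \<Longrightarrow> (q, p) \<in> P \<Longrightarrow> \<phi> q \<Longrightarrow> \<exists>s. (s, q) \<in> P \<and> \<phi> s"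
  using poset_refl by (metis FieldI1)

text \<open>Everything that a condition below \<open>r\<close> can force into the name lies in one
  ground model set; an injection of that set into the naturals still witnesses countability in the
  extension.\<close>

lemma fm_countableI:
  fixes N :: "('x, 'p) nam"
  assumes P: "poset P" and countable: "countable {x. \<exists>s. (s, r) \<in> P \<and> fm_mem P x N s}"
  shows "fm_countable P N r"
proof -
  define X where "X = {x. \<exists>s. (s, r) \<in> P \<and> fm_mem P x N s}"
  obtain f :: "'x \<Rightarrow> nat" where f: "inj_on f X"
    using countable unfolding X_def countable_def by blast
  \<comment> \<open>This is the canonical name of the graph of \<open>f\<close> on \<open>X\<close>:
    every condition is attached to every pair, so all conditions decide membership alike.\<close>
  define e where "e = {((x, f x), t) | x t. x \<in> X \<and> t \<in> Field P}"
  have mem_e: "fm_mem P (x, i) e q \<longleftrightarrow> x \<in> X \<and> i = f x" if q: "q \<in> Field P" for x i q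
  proof
    assume "fm_mem P (x, i) e q"
    then obtain t where "((x, i), t) \<in> e"
      using poset_refl[OF P q] unfolding fm_mem_def by blast
    then show "x \<in> X \<and> i = f x" unfolding e_def by blast
  next
    assume xi: "x \<in> X \<and> i = f x"
    show "fm_mem P (x, i) e q"
      unfolding fm_mem_def
    proof (intro allI impI)
      fix q' assume "(q', q) \<in> P"
      then have "q' \<in> Field P" by (rule FieldI1)
      then show "\<exists>s. (s, q') \<in> P \<and> (\<exists>t. ((x, i), t) \<in> e \<and> (s, t) \<in> P)"
        using xi poset_refl[OF P] unfolding e_def by blast
    qed
  qed
  show ?thesis
    unfolding fm_countable_def
  proof (rule fm_exI)
    fix q assume q: "(q, r) \<in> P"
    have le_r: "(q', r) \<in> P" if "(q', q) \<in> P" for q'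
      using poset_trans[OF P] that q by (rule transD)
    show "\<exists>s (x :: ('x \<times> nat, 'p) nam). (s, q) \<in> P \<and> fm_and
        (fm_all (\<lambda>xa. fm_imp P (fm_mem P xa N) (fm_ex P (\<lambda>k. fm_mem P (xa, k) x))))
        (fm_and
          (fm_all (\<lambda>xa. fm_all (\<lambda>k. fm_all (\<lambda>k'.
            fm_imp P (fm_and (fm_mem P (xa, k) x) (fm_mem P (xa, k') x)) (fm_ground (k = k'))))))
          (fm_all (\<lambda>xa. fm_all (\<lambda>y. fm_all (\<lambda>k.
            fm_imp P (fm_and (fm_mem P (xa, k) x) (fm_mem P (y, k) x)) (fm_ground (xa = y))))))) s"
    proof (intro exI[of _ q] exI[of _ e] conjI)
      show "(q, q) \<in> P" by (rule poset_refl[OF P FieldI1[OF q]])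
      have 1: "fm_imp P (fm_mem P x N) (fm_ex P (\<lambda>k. fm_mem P (x, k) e)) q" for x
      proof (rule fm_impI, rule poset_ex_self[OF P], assumption, rule fm_exI)
        fix q' q'' assume q': "(q', q) \<in> P" "fm_mem P x N q'" "(q'', q') \<in> P"
        have "x \<in> X" using le_r[OF q'(1)] q'(2) unfolding X_def by blast
        then have "fm_mem P (x, f x) e q''" using mem_e[OF FieldI1[OF q'(3)]] by simp
        then show "\<exists>s k. (s, q'') \<in> P \<and> fm_mem P (x, k) e s"
          using poset_refl[OF P FieldI1[OF q'(3)]] by blast
      qed
      have 2: "fm_imp P (fm_and (fm_mem P (x, k) e) (fm_mem P (x, k') e)) (fm_ground (k = k')) q"
        for x k k'
      proof (rule fm_impI, rule poset_ex_self[OF P], assumption)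
        fix q' assume "(q', q) \<in> P" "fm_and (fm_mem P (x, k) e) (fm_mem P (x, k') e) q'"
        then show "fm_ground (k = k') q'"
          using mem_e[OF FieldI1] unfolding fm_and_def fm_ground_def by metis
      qed
      have 3: "fm_imp P (fm_and (fm_mem P (x, k) e) (fm_mem P (y, k) e)) (fm_ground (x = y)) q"
        for x y k
      proof (rule fm_impI, rule poset_ex_self[OF P], assumption)
        fix q' assume "(q', q) \<in> P" "fm_and (fm_mem P (x, k) e) (fm_mem P (y, k) e) q'"
        then show "fm_ground (x = y) q'"
          using mem_e[OF FieldI1] f unfolding fm_and_def fm_ground_def inj_on_def by metis
      qed
      show "fm_and
        (fm_all (\<lambda>xa. fm_imp P (fm_mem P xa N) (fm_ex P (\<lambda>k. fm_mem P (xa, k) e))))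
        (fm_and
          (fm_all (\<lambda>xa. fm_all (\<lambda>k. fm_all (\<lambda>k'.
            fm_imp P (fm_and (fm_mem P (xa, k) e) (fm_mem P (xa, k') e)) (fm_ground (k = k'))))))
          (fm_all (\<lambda>xa. fm_all (\<lambda>y. fm_all (\<lambda>k.
            fm_imp P (fm_and (fm_mem P (xa, k) e) (fm_mem P (y, k) e)) (fm_ground (xa = y))))))) q"
        using 1 2 3 unfolding fm_and_def fm_all_def by blast
    qed
  qed
qed

text \<open>If \<open>r\<close> forces \<open>S\<close> to be uncountable, its possible elements
  below \<open>r\<close> form an uncountable ground model family. With \<open>c A\<close> below
  \<open>r\<close> forcing \<open>A\<close> into \<open>S\<close>, the hypothesis \<open>key\<close>
  yields a captured family and one condition forcing all its members into \<open>S\<close>.\<close>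

lemma forces_fm_n_capturingI:
  fixes P :: "'p rel"
  assumes P: "poset P" and n: "0 < n"
    and key: "\<And>X c N. uncountable X \<Longrightarrow> (\<And>D. D \<in> X \<Longrightarrow> finite D) \<Longrightarrow> c ` X \<subseteq> Field P \<Longrightarrow>
      \<exists>l D s. N \<le> l \<and> inj_on D {..<n} \<and> D ` {..<n} \<subseteq> X \<and> captured_family \<tau> \<F> l n D \<and>
        (\<forall>i<n. (s, c (D i)) \<in> P)"
  shows "forces P (fm_n_capturing P \<tau> \<F> n)"
proof -
  have tr: "\<And>x y z. (x, y) \<in> P \<Longrightarrow> (y, z) \<in> P \<Longrightarrow> (x, z) \<in> P"
    using poset_trans[OF P] by (rule transD)
  have main: "\<exists>s l D. (s, r) \<in> P \<and> k \<le> l \<and> inj_on D {..<n} \<and> captured_family \<tau> \<F> l n D \<and>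
      (\<forall>i<n. fm_mem P (D i) S s)"
    if fin: "\<And>A. fm_imp P (fm_mem P A S) (fm_ground (finite A)) q"
      and unc: "fm_not P (fm_countable P S) q" and r: "(r, q) \<in> P"
    for S :: "(omega1 set, 'p) nam" and q r k
  proof -
    define X where "X = {A. \<exists>s. (s, r) \<in> P \<and> fm_mem P A S s}"
    have "\<not> fm_countable P S r" using unc r unfolding fm_not_def by blast
    then have uX: "uncountable X" using fm_countableI[OF P] unfolding X_def by blast
    have "\<forall>A\<in>X. \<exists>s. (s, r) \<in> P \<and> fm_mem P A S s" unfolding X_def by blast
    then obtain c where c: "\<And>A. A \<in> X \<Longrightarrow> (c A, r) \<in> P" "\<And>A. A \<in> X \<Longrightarrow> fm_mem P A S (c A)"
      by metis
    have "finite A" if "A \<in> X" for A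
      using fm_impD[OF fin tr[OF c(1)[OF that] r] c(2)[OF that]] unfolding fm_ground_def by blast
    moreover have "c ` X \<subseteq> Field P" using c(1) by (auto intro: FieldI1)
    ultimately obtain l D s where lDs: "k \<le> l" "inj_on D {..<n}" "D ` {..<n} \<subseteq> X"
      "captured_family \<tau> \<F> l n D" "\<forall>i<n. (s, c (D i)) \<in> P"
      using key[OF uX, of c k] by auto
    have DX: "D i \<in> X" if "i < n" for i using lDs(3) that by auto
    have "(s, r) \<in> P" using lDs(5) n c(1)[OF DX[OF n]] tr by blast
    moreover have "fm_mem P (D i) S s" if "i < n" for i
      using fm_mem_mono[OF poset_trans[OF P] c(2)[OF DX[OF that]]] lDs(5) that by blast
    ultimately show ?thesis using lDs(1,2,4) by blast
  qed
  show ?thesis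
    unfolding forces_def fm_n_capturing_def
  proof (rule ballI, rule fm_allI, rule fm_impI)
    fix p q and S :: "(omega1 set, 'p) nam"
    assume q: "(q, p) \<in> P"
      and \<phi>: "fm_and (fm_all (\<lambda>A. fm_imp P (fm_mem P A S) (fm_ground (finite A))))
        (fm_not P (fm_countable P S)) q"
    have fin: "\<And>A. fm_imp P (fm_mem P A S) (fm_ground (finite A)) q"
      and unc: "fm_not P (fm_countable P S) q"
      using \<phi> unfolding fm_and_def fm_all_def by blast+
    show "\<exists>s. (s, q) \<in> P \<and> fm_all (\<lambda>k :: nat. fm_ex P (\<lambda>l. fm_ex P (\<lambda>D :: nat \<Rightarrow> omega1 set.
        fm_and
          (fm_ground (k \<le> l \<and> inj_on D {..<n} \<and> captured_family \<tau> \<F> l n D))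
          (fm_all (\<lambda>i. fm_imp P (fm_ground (i < n)) (fm_mem P (D i) S)))))) s"
    proof (rule poset_ex_self[OF P q], rule fm_allI, rule fm_exI)
      fix k r assume "(r, q) \<in> P"
      then obtain s l D where s: "(s, r) \<in> P" "k \<le> l" "inj_on D {..<n}"
        "captured_family \<tau> \<F> l n D" "\<forall>i<n. fm_mem P (D i) S s"
        using main[OF fin unc] by blast
      have "fm_ex P (\<lambda>D :: nat \<Rightarrow> omega1 set.
        fm_and
          (fm_ground (k \<le> l \<and> inj_on D {..<n} \<and> captured_family \<tau> \<F> l n D))
          (fm_all (\<lambda>i. fm_imp P (fm_ground (i < n)) (fm_mem P (D i) S)))) s"
      proof (rule fm_exI)
        fix s' assume s': "(s', s) \<in> P"
        have mem: "fm_imp P (fm_ground (i < n)) (fm_mem P (D i) S) s'" for i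
        proof (rule fm_impI, rule poset_ex_self[OF P], assumption)
          fix s'' assume s'': "(s'', s') \<in> P" "fm_ground (i < n) s''"
          have "fm_mem P (D i) S s" using s(5) s''(2) unfolding fm_ground_def by simp
          then show "fm_mem P (D i) S s''"
            by (rule fm_mem_mono[OF poset_trans[OF P] _ tr[OF s''(1) s']])
        qed
        show "\<exists>s'' D. (s'', s') \<in> P \<and> fm_and
          (fm_ground (k \<le> l \<and> inj_on D {..<n} \<and> captured_family \<tau> \<F> l n D))
          (fm_all (\<lambda>i. fm_imp P (fm_ground (i < n)) (fm_mem P (D i) S))) s''"
        proof (intro exI conjI)
          show "(s', s') \<in> P" by (rule poset_refl[OF P FieldI1[OF s']])
          show "fm_and (fm_ground (k \<le> l \<and> inj_on D {..<n} \<and> captured_family \<tau> \<F> l n D))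
            (fm_all (\<lambda>i. fm_imp P (fm_ground (i < n)) (fm_mem P (D i) S))) s'"
            unfolding fm_and_def
          proof
            show "fm_ground (k \<le> l \<and> inj_on D {..<n} \<and> captured_family \<tau> \<F> l n D) s'"
              using s(2-4) unfolding fm_ground_def by simp
          qed (rule fm_allI, rule mem)
        qed
      qed
      then show "\<exists>s l. (s, r) \<in> P \<and> fm_ex P (\<lambda>D :: nat \<Rightarrow> omega1 set.
        fm_and
          (fm_ground (k \<le> l \<and> inj_on D {..<n} \<and> captured_family \<tau> \<F> l n D))
          (fm_all (\<lambda>i. fm_imp P (fm_ground (i < n)) (fm_mem P (D i) S)))) s"
        using s(1) by blast
    qed
  qed
qed

section \<open>Generic uncountable sets\<close>

lemma uncountable_omega1_set_iff:
  fixes S :: "omega1 set"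
  shows "|S| =o cardSuc natLeq \<longleftrightarrow> uncountable S"
proof
  assume S: "|S| =o cardSuc natLeq"
  show "uncountable S"
  proof
    assume "countable S"
    then have "|S| \<le>o natLeq" by (simp add: countable_card_le_natLeq)
    then have "|S| <o cardSuc natLeq"
      using cardSuc_greater[OF natLeq_Card_order] ordLeq_ordLess_trans by blast
    then show False using S not_ordLess_ordIso by blast
  qed
next
  assume "uncountable S"
  then have "natLeq <o |S|"
    by (simp add: countable_card_le_natLeq natLeq_Card_order card_of_Card_order Card_order_iff_ordLeq_card_of not_ordLeq_iff_ordLess natLeq_Well_order card_of_Well_order)
  then have "cardSuc natLeq \<le>o |S|"
    by (simp add: cardSuc_least natLeq_Card_order card_of_Card_order)
  moreover have "|S| \<le>o |UNIV :: omega1 set|" by (rule card_of_mono1) simp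
  then have "|S| \<le>o cardSuc natLeq" using card_of_omega1 ordLeq_ordIso_trans by blast
  ultimately show "|S| =o cardSuc natLeq" by (simp add: ordIso_iff_ordLeq)
qed

section \<open>Coding posets of finite sets in the prescribed type\<close>

lemma inj_omega1_nat_set: "\<exists>f :: omega1 \<Rightarrow> nat set. inj f"
proof -
  have "natLeq <o |UNIV :: nat set set|"
    using card_of_Pow[of "UNIV :: nat set"] card_of_nat ordIso_ordLess_trans ordIso_symmetric
    by (metis Pow_UNIV)
  then have "cardSuc natLeq \<le>o |UNIV :: nat set set|"
    by (simp add: cardSuc_least natLeq_Card_order card_of_Card_order)
  then have "|UNIV :: omega1 set| \<le>o |UNIV :: nat set set|"
    using card_of_omega1 ordIso_ordLeq_trans by blast
  then show ?thesis unfolding card_of_ordLeq[symmetric] by blast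
qed

text \<open>\<open>is_m_capturing\<close> only speaks about posets carried by \<open>'p\<close>, so
  the finite conditions must be represented there.\<close>

lemma inj_on_finite_omega1_sets:
  assumes "|UNIV :: nat set set| \<le>o |UNIV :: 'p set|"
  shows "\<exists>e :: omega1 set \<Rightarrow> 'p. inj_on e {A. finite A}"
proof -
  obtain f :: "omega1 \<Rightarrow> nat set" where f: "inj f" using inj_omega1_nat_set by blast
  obtain h :: "nat set \<Rightarrow> 'p" where h: "inj h"
    using assms unfolding card_of_ordLeq[symmetric] by blast
  \<comment> \<open>Row 0 records the cardinality, and row \<open>Suc i\<close> the set of naturals
    that \<open>f\<close> assigns to the \<open>i\<close>-th element.\<close>
  define code where "code A = insert (prod_encode (0, card A))
    {prod_encode (Suc i, x) | i x. i < card A \<and> x \<in> f (elt A i)}" for A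
  have code0: "prod_encode (0, c) \<in> code A \<longleftrightarrow> c = card A" for c A
    unfolding code_def by auto
  have codeS: "prod_encode (Suc i, x) \<in> code A \<longleftrightarrow> i < card A \<and> x \<in> f (elt A i)" for i x A
    unfolding code_def by auto
  have "inj_on code {A. finite A}"
  proof (rule inj_onI)
    fix A B assume AB: "A \<in> {A. finite A}" "B \<in> {A. finite A}" and eq: "code A = code B"
    have card: "card A = card B" using code0[of "card A" A] code0[of "card A" B] eq by simp
    have "elt A i = elt B i" if "i < card A" for i
    proof -
      have "f (elt A i) = f (elt B i)"
        using codeS[of i _ A] codeS[of i _ B] eq card that by auto
      then show ?thesis using f by (simp add: inj_eq)
    qed
    then have "elt A ` {..<card A} = elt B ` {..<card B}" using card by auto
    then show "A = B" using AB elt_image by simp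
  qed
  then have "inj_on (h \<circ> code) {A. finite A}"
    by (rule comp_inj_on) (rule inj_on_subset[OF h subset_UNIV])
  then show ?thesis by blast
qed

text \<open>An unmet family makes \<mm>(\<open>P\<close>) exist, as the least cardinality of such a
  family; minimality of \<kappa> compares it with that value.\<close>

lemma is_m_capturing_le_unmet:
  fixes P :: "'p rel" and \<kappa> :: "'p set rel"
  assumes \<kappa>: "is_m_capturing \<tau> \<F> n \<kappa>"
    and P: "poset P" "ccc P" "forces P (fm_n_capturing P \<tau> \<F> n)" and unmet: "unmet P \<D>"
  shows "\<kappa> \<le>o |\<D>|"
proof -
  define M where "M = {|\<D>| | \<D>. unmet P \<D>}"
  have "M \<noteq> {}" "\<forall>r\<in>M. Well_order r"
    using unmet unfolding M_def by (auto simp: card_of_Well_order)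
  then obtain \<mu> where \<mu>: "\<mu> \<in> M" "\<forall>r\<in>M. \<mu> \<le>o r"
    using exists_minim_Well_order by blast
  obtain \<D>' where "unmet P \<D>'" "\<mu> = |\<D>'|" using \<mu>(1) unfolding M_def by blast
  then have "is_m P \<mu>"
    using \<mu>(2) unfolding is_m_def M_def by (auto intro: ordIso_refl card_of_Card_order)
  then have "\<kappa> \<le>o \<mu>" using \<kappa> P unfolding is_m_capturing_def by blast
  moreover have "\<mu> \<le>o |\<D>|" using \<mu>(2) unmet unfolding M_def by blast
  ultimately show ?thesis by (rule ordLeq_transitive)
qed

text \<open>Reverse inclusion on \<A>, transported along \<open>e\<close>: larger sets are
  stronger.\<close>

definition coded_poset :: "('a set \<Rightarrow> 'p) \<Rightarrow> 'a set set \<Rightarrow> 'p rel"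
  where "coded_poset e \<A> = {(e q, e p) | q p. p \<in> \<A> \<and> q \<in> \<A> \<and> p \<subseteq> q}"

lemma Field_coded_poset: "Field (coded_poset e \<A>) = e ` \<A>"
  unfolding coded_poset_def Field_def by auto

lemma coded_poset_iff:
  "inj_on e \<A> \<Longrightarrow> p \<in> \<A> \<Longrightarrow> q \<in> \<A> \<Longrightarrow> (e q, e p) \<in> coded_poset e \<A> \<longleftrightarrow> p \<subseteq> q"
  unfolding coded_poset_def by (auto dest: inj_onD)

lemma poset_coded_poset:
  assumes e: "inj_on e \<A>" and "\<A> \<noteq> {}"
  shows "poset (coded_poset e \<A>)"
proof -
  have "refl_on (e ` \<A>) (coded_poset e \<A>)"
    unfolding coded_poset_def refl_on_def by auto
  moreover have "coded_poset e \<A> \<subseteq> e ` \<A> \<times> e ` \<A>"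
    unfolding coded_poset_def by auto
  moreover have "trans (coded_poset e \<A>)"
  proof (rule transI)
    fix x y z assume "(x, y) \<in> coded_poset e \<A>" "(y, z) \<in> coded_poset e \<A>"
    then obtain p q q' s where "x = e q" "y = e p" "p \<in> \<A>" "q \<in> \<A>" "p \<subseteq> q"
      "y = e q'" "z = e s" "q' \<in> \<A>" "s \<in> \<A>" "s \<subseteq> q'"
      unfolding coded_poset_def by auto
    moreover from this have "p = q'" using e by (auto dest: inj_onD)
    ultimately show "(x, z) \<in> coded_poset e \<A>"
      unfolding coded_poset_def by auto
  qed
  moreover have "antisym (coded_poset e \<A>)"
  proof (rule antisymI)
    fix x y assume xy: "(x, y) \<in> coded_poset e \<A>" "(y, x) \<in> coded_poset e \<A>"
    then obtain p q where pq: "x = e q" "y = e p" "p \<in> \<A>" "q \<in> \<A>"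
      unfolding coded_poset_def by auto
    then show "x = y" using xy coded_poset_iff[OF e] by auto
  qed
  ultimately show ?thesis
    using assms(2) Field_coded_poset[of e \<A>]
    unfolding poset_def partial_order_on_def preorder_on_def by auto
qed

text \<open>Conditions are finite approximations to \<open>S'\<close>. Amalgamating captured
  conditions gives ccc and the forcing of capturing, and a filter meeting \<omega>1 many dense sets
  makes the union unbounded.\<close>

lemma (in scheme) generic_uncountable_set:
  fixes \<kappa> :: "'p set rel"
  assumes n: "2 \<le> n" and big: "|UNIV :: nat set set| \<le>o |UNIV :: 'p set|"
    and \<kappa>: "is_m_capturing \<tau> \<F> n \<kappa>" "cardSuc natLeq <o \<kappa>"
    and S: "uncountable S"
    and C_empty: "C {}" and C_mono: "\<And>Q Q'. C Q \<Longrightarrow> Q' \<subseteq> Q \<Longrightarrow> C Q'"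
    and C_extend: "\<And>Q T. finite Q \<Longrightarrow> C Q \<Longrightarrow> T \<subseteq> S \<Longrightarrow> uncountable T \<Longrightarrow>
      \<exists>l\<in>pi_set \<tau> \<F> n T. C (insert l Q)"
  obtains S' where "S' \<subseteq> S" "uncountable S'"
    "\<And>p. finite p \<Longrightarrow> p \<subseteq> S' \<Longrightarrow> C (pi_set \<tau> \<F> n p)"
proof -
  define cond where "cond p \<longleftrightarrow> finite p \<and> p \<subseteq> S \<and> C (pi_set \<tau> \<F> n p)" for p
  \<comment> \<open>Uncountably many conditions, indexed by finite sets, contain \<open>n\<close>
    whose indices form a captured family and whose union is again a condition.\<close>
  have amalgam: "\<exists>l D. N < l \<and> inj_on D {..<n} \<and> D ` {..<n} \<subseteq> X \<and> captured_family \<tau> \<F> l n D \<and>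
      cond (\<Union>i<n. p (D i))"
    if X: "uncountable X" "\<And>D. D \<in> X \<Longrightarrow> finite D" and p: "\<And>D. D \<in> X \<Longrightarrow> cond (p D)"
    for X p N
  proof -
    have finp: "finite (p D)" if "D \<in> X" for D using p[OF that] unfolding cond_def by simp
    obtain T Q where TQ: "T \<subseteq> S" "uncountable T" "finite Q"
      and T: "\<And>l. l \<in> pi_set \<tau> \<F> n T \<Longrightarrow> N < l \<and> (\<exists>D. inj_on D {..<n} \<and> D ` {..<n} \<subseteq> X \<and>
      captured_family \<tau> \<F> l n D \<and> (\<forall>i<n. pi_set \<tau> \<F> n (p (D i)) = Q) \<and>
      pi_set \<tau> \<F> n (\<Union>i<n. p (D i)) \<subseteq> insert l Q)"
      by (rule uncountable_family_refine[OF n S X(1), where p = p and N = N])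
        (erule X(2) finp | rule that, assumption+)+
    have out: "N < l \<and> (\<exists>D. inj_on D {..<n} \<and> D ` {..<n} \<subseteq> X \<and> captured_family \<tau> \<F> l n D \<and>
        C Q \<and> (C (insert l Q) \<longrightarrow> cond (\<Union>i<n. p (D i))))"
      if l: "l \<in> pi_set \<tau> \<F> n T" for l
    proof -
      obtain D where D: "N < l" "inj_on D {..<n}" "D ` {..<n} \<subseteq> X" "captured_family \<tau> \<F> l n D"
        "\<forall>i<n. pi_set \<tau> \<F> n (p (D i)) = Q" "pi_set \<tau> \<F> n (\<Union>i<n. p (D i)) \<subseteq> insert l Q"
        using T[OF l] by blast
      have pD: "cond (p (D i))" if "i < n" for i using p D(3) that by auto
      have "C Q" using pD[of 0] D(5) n unfolding cond_def by auto
      moreover have "cond (\<Union>i<n. p (D i))" if "C (insert l Q)"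
        using C_mono[OF that D(6)] pD unfolding cond_def by auto
      ultimately show ?thesis using D(1-4) by blast
    qed
    \<comment> \<open>The property \<open>C_extend\<close> is used twice: for the empty set, to find
      any captured level and thereby learn \<open>C Q\<close>, and then for \<open>Q\<close>
      itself.\<close>
    have "\<exists>l. l \<in> pi_set \<tau> \<F> n T"
      using C_extend[OF finite.emptyI C_empty TQ(1,2)] by blast
    then have "C Q" using out by blast
    then obtain l where "l \<in> pi_set \<tau> \<F> n T" "C (insert l Q)"
      using C_extend[OF TQ(3) _ TQ(1,2)] by blast
    then show ?thesis using out[of l] by blast
  qed
  have pi_single: "pi_set \<tau> \<F> n {s} = {}" for s
  proof -
    have False if l: "l \<in> pi_set \<tau> \<F> n {s}" for l
    proof -
      obtain t where t: "captured_tuple l n t" "t ` {..<n} \<subseteq> {s}"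
        using l unfolding mem_pi_set_iff[OF n] by blast
      then have "t 0 = t 1" using n by (auto simp: image_subset_iff)
      then show False using inj_onD[OF captured_tuple_inj[OF t(1)], of 0 1] n by simp
    qed
    then show ?thesis by blast
  qed
  \<comment> \<open>Below some condition the generic set is forced to be unbounded, hence uncountable.\<close>
  have "\<exists>p0. cond p0 \<and> (\<forall>q \<beta>. cond q \<and> p0 \<subseteq> q \<longrightarrow> (\<exists>r. cond r \<and> q \<subseteq> r \<and> (\<exists>s\<in>r. \<beta> < s)))"
  proof (rule ccontr)
    assume "\<not> ?thesis"
    \<comment> \<open>If no \<open>p0\<close> works, every condition has an extension
      \<open>q\<close> and a bound that no further extension of \<open>q\<close> can exceed.\<close>
    then have ex: "\<exists>q \<beta>. cond q \<and> p \<subseteq> q \<and> (\<forall>r. cond r \<and> q \<subseteq> r \<longrightarrow> (\<forall>s\<in>r. s \<le> \<beta>))" if "cond p" for p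
      using that by (meson not_le)
    have "cond {s}" if "s \<in> S" for s
      using that pi_single C_empty unfolding cond_def by simp
    then have "\<forall>s\<in>S. \<exists>q \<beta>. cond q \<and> {s} \<subseteq> q \<and> (\<forall>r. cond r \<and> q \<subseteq> r \<longrightarrow> (\<forall>s\<in>r. s \<le> \<beta>))"
      using ex by blast
    then obtain q b where qb: "\<And>s. s \<in> S \<Longrightarrow> cond (q s)" "\<And>s. s \<in> S \<Longrightarrow> s \<in> q s"
      "\<And>s r x. s \<in> S \<Longrightarrow> cond r \<Longrightarrow> q s \<subseteq> r \<Longrightarrow> x \<in> r \<Longrightarrow> x \<le> b s"
      by (metis insert_subset)
    have sb: "s \<le> b s" if "s \<in> S" for s using qb(3)[OF that qb(1)[OF that]] qb(2)[OF that] by simp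
    \<comment> \<open>Two captured pairs \<open>{s, b s}\<close> are disjoint and consecutive, so the second \<open>s\<close> exceeds the first bound.\<close>
    define X where "X = (\<lambda>s. {s, b s}) ` S"
    have Min: "Min {s, b s} = s" if "s \<in> S" for s using sb[OF that] by (simp add: min_def)
    have "inj_on (\<lambda>s. {s, b s}) S"
    proof (rule inj_onI)
      fix x y assume "x \<in> S" "y \<in> S" "{x, b x} = {y, b y}"
      then show "x = y" using Min[of x] Min[of y] by argo
    qed
    then have X: "uncountable X"
      using S countable_image_inj_on unfolding X_def by blast
    have "cond (q (Min D))" if "D \<in> X" for D using that qb(1) Min unfolding X_def by fastforce
    moreover have "finite D" if "D \<in> X" for D using that unfolding X_def by auto
    \<comment> \<open>The conditions \<open>q s\<close> are indexed by the pairs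
      \<open>{s, b s}\<close>, from which \<open>Min\<close> recovers \<open>s\<close>.\<close>
    ultimately obtain l D where D: "inj_on D {..<n}" "D ` {..<n} \<subseteq> X"
      "captured_family \<tau> \<F> l n D" and r: "cond (\<Union>i<n. q (Min (D i)))"
      using amalgam[OF X, of "\<lambda>D. q (Min D)" 0] by blast
    obtain R where rtt: "root_tail_tail n D R" using D(3) unfolding captured_family_def by blast
    have "D 0 \<in> X" "D 1 \<in> X" using D(2) n by auto
    then obtain s0 s1 where s: "s0 \<in> S" "D 0 = {s0, b s0}" "s1 \<in> S" "D 1 = {s1, b s1}"
      unfolding X_def by auto
    have "s1 \<in> (\<Union>i<n. q (Min (D i)))"
      using qb(2)[OF s(3)] Min[OF s(3)] s(4) n by (intro UN_I[of 1]) auto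
    moreover have "q s0 \<subseteq> (\<Union>i<n. q (Min (D i)))"
      using Min[OF s(1)] s(2) n by (intro UN_upper[of 0, THEN subset_trans[rotated]]) auto
    \<comment> \<open>The union is a condition extending \<open>q s0\<close> and containing
      \<open>s1\<close>, so the bound attached to \<open>s0\<close> applies to
      \<open>s1\<close>.\<close>
    ultimately have s1: "s1 \<le> b s0" using qb(3)[OF s(1) r] by blast
    have R: "R \<subseteq> D 0" "R \<subseteq> D 1" "set_less R (D 0 - R)" "set_less R (D 1 - R)"
      "D 0 \<inter> D 1 = R" "set_less (D 0 - R) (D 1 - R)"
      using rtt n unfolding root_tail_tail_def by simp_all
    have "D 0 \<noteq> D 1" using inj_onD[OF D(1), of 0 1] n by auto
    then have "s0 \<noteq> s1" using s by auto
    \<comment> \<open>If \<open>s0\<close> were in the root, it would equal \<open>b s1\<close>,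
      which lies above \<open>s1\<close>, and \<open>s1\<close> would be a tail point below a root
      point. Otherwise the root is empty and the first pair lies entirely below
      \<open>s1\<close>.\<close>
    show False
    proof (cases "s0 \<in> R")
      case True
      then have "s1 < s0" using R(2) s(4) sb[OF s(3)] \<open>s0 \<noteq> s1\<close> by auto
      have "s1 \<notin> R"
        using R(1) s(2) sb[OF s(1)] \<open>s1 < s0\<close> by auto
      then have "s0 < s1" using R(4) True s(4) unfolding set_less_def by simp
      then show False using \<open>s1 < s0\<close> by simp
    next
      case False
      have "b s0 \<notin> R"
      proof
        assume "b s0 \<in> R"
        then have "b s0 < s0" using R(3) False s(2) unfolding set_less_def by simp
        then show False using sb[OF s(1)] by simp
      qed
      then have "R = {}" using R(1) s(2) False by auto
      then have "b s0 < s1" using R(6) s(2,4) unfolding set_less_def by simp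
      then show False using s1 by simp
    qed
  qed
  then obtain p0 where p0: "cond p0"
    "\<And>q \<beta>. cond q \<Longrightarrow> p0 \<subseteq> q \<Longrightarrow> \<exists>r. cond r \<and> q \<subseteq> r \<and> (\<exists>s\<in>r. \<beta> < s)" by metis
  obtain e :: "omega1 set \<Rightarrow> 'p" where "inj_on e {A. finite A}"
    using inj_on_finite_omega1_sets[OF big] by blast
  define \<A> where "\<A> = {p. cond p \<and> p0 \<subseteq> p}"
  define P where "P = coded_poset e \<A>"
  have e: "inj_on e \<A>"
    by (rule inj_on_subset[OF \<open>inj_on e {A. finite A}\<close>]) (auto simp: \<A>_def cond_def)
  have P_iff: "(e q, e p) \<in> P \<longleftrightarrow> p \<subseteq> q" if "p \<in> \<A>" "q \<in> \<A>" for p q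
    unfolding P_def using coded_poset_iff[OF e that] .
  have Field: "Field P = e ` \<A>" unfolding P_def by (rule Field_coded_poset)
  have "p0 \<in> \<A>" using p0(1) unfolding \<A>_def by simp
  then have poset: "poset P" unfolding P_def by (intro poset_coded_poset[OF e]) blast
  have amalgam_P: "\<exists>l D s. N \<le> l \<and> inj_on D {..<n} \<and> D ` {..<n} \<subseteq> X \<and>
      captured_family \<tau> \<F> l n D \<and> (\<forall>i<n. (s, c (D i)) \<in> P)"
    if X: "uncountable X" "\<And>D. D \<in> X \<Longrightarrow> finite D" and c: "c ` X \<subseteq> Field P" for X c N
  proof -
    have "\<forall>D\<in>X. \<exists>p\<in>\<A>. c D = e p" using c Field by auto
    then obtain p where p: "\<And>D. D \<in> X \<Longrightarrow> p D \<in> \<A>" "\<And>D. D \<in> X \<Longrightarrow> c D = e (p D)" by metis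
    have "cond (p D)" if "D \<in> X" for D using p(1)[OF that] unfolding \<A>_def by simp
    then obtain l D where D: "N < l" "inj_on D {..<n}" "D ` {..<n} \<subseteq> X" "captured_family \<tau> \<F> l n D"
      "cond (\<Union>i<n. p (D i))"
      using amalgam[OF X, of p N] by blast
    have DX: "D i \<in> X" if "i < n" for i using D(3) that by auto
    have "p0 \<subseteq> p (D 0)" using p(1)[OF DX, of 0] n unfolding \<A>_def by auto
    then have U: "(\<Union>i<n. p (D i)) \<in> \<A>" using D(5) n unfolding \<A>_def by force
    have "(e (\<Union>i<n. p (D i)), c (D i)) \<in> P" if "i < n" for i
      using P_iff[OF p(1)[OF DX[OF that]] U] p(2)[OF DX[OF that]] that by auto
    then show ?thesis using D(1-4) less_imp_le by blast
  qed
  have "ccc P"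
    unfolding ccc_def
  proof (intro allI impI)
    fix A assume A: "A \<subseteq> Field P" and anti: "\<forall>p\<in>A. \<forall>q\<in>A. p \<noteq> q \<longrightarrow> \<not> compatible P p q"
    \<comment> \<open>Conditions are themselves finite sets, so the antichain serves as its own
      index family, and \<open>n\<close> at least 2 gives two compatible members.\<close>
    define X where "X = {p \<in> \<A>. e p \<in> A}"
    have eX: "e ` X = A" using A Field unfolding X_def by auto
    show "countable A"
    proof (rule ccontr)
      assume "uncountable A"
      then have uX: "uncountable X" using eX by auto
      have "e ` X \<subseteq> Field P" using eX A by simp
      moreover have "finite D" if "D \<in> X" for D using that unfolding X_def \<A>_def cond_def by simp
      ultimately obtain D s where D: "inj_on D {..<n}" "D ` {..<n} \<subseteq> X" "\<forall>i<n. (s, e (D i)) \<in> P"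
        using amalgam_P[OF uX, of e 0] by blast
      have DX: "D 0 \<in> X" "D 1 \<in> X" using D(2) n by auto
      have "D 0 \<noteq> D 1" using inj_onD[OF D(1), of 0 1] n by auto
      then have "e (D 0) \<noteq> e (D 1)" using inj_onD[OF e] DX unfolding X_def by blast
      moreover have "compatible P (e (D 0)) (e (D 1))"
        using D(3)[rule_format, of 0] D(3)[rule_format, of 1] n unfolding compatible_def by auto
      ultimately show False using anti DX eX by blast
    qed
  qed
  have forces: "forces P (fm_n_capturing P \<tau> \<F> n)"
    using n amalgam_P by (intro forces_fm_n_capturingI[OF poset]) auto
  define dense where "dense \<beta> = e ` {q \<in> \<A>. \<exists>s\<in>q. \<beta> < s}" for \<beta> :: omega1
  have dense: "dense_in P (dense \<beta>)" for \<beta>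
    unfolding dense_in_def
  proof (intro conjI ballI)
    show "dense \<beta> \<subseteq> Field P" unfolding dense_def Field by auto
    fix x assume "x \<in> Field P"
    then obtain p where p: "x = e p" "p \<in> \<A>" using Field by auto
    then obtain r s where r: "cond r" "p \<subseteq> r" "s \<in> r" "\<beta> < s"
      using p0(2)[of p \<beta>] unfolding \<A>_def by auto
    have "r \<in> \<A>" using r p(2) unfolding \<A>_def by auto
    then have "e r \<in> dense \<beta>" using r unfolding dense_def by auto
    then show "\<exists>q\<in>dense \<beta>. (q, x) \<in> P" using P_iff[OF p(2) \<open>r \<in> \<A>\<close>] r(2) p(1) by blast
  qed
  have "\<not> unmet P (range dense)"
  proof
    assume "unmet P (range dense)"
    \<comment> \<open>There are at most \<omega>1 many of these dense sets, while \<kappa> is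
      larger.\<close>
    then have "\<kappa> \<le>o |range dense|"
      by (rule is_m_capturing_le_unmet[OF \<kappa>(1) poset \<open>ccc P\<close> forces])
    moreover have "|range dense| \<le>o |UNIV :: omega1 set|" by (rule card_of_image)
    ultimately have "\<kappa> \<le>o cardSuc natLeq"
      using card_of_omega1 ordLeq_transitive ordLeq_ordIso_trans by blast
    then show False using \<kappa>(2) not_ordLess_ordLeq by blast
  qed
  then obtain G where G: "filter_on P G" "\<And>\<beta>. G \<inter> dense \<beta> \<noteq> {}"
    using dense unfolding unmet_def by auto
  define S' where "S' = \<Union>{p \<in> \<A>. e p \<in> G}"
  \<comment> \<open>By directedness one condition of the filter contains any given finite part of
    \<open>S'\<close>; monotonicity then passes \<open>C\<close> down to that part.\<close>
  have sub: "\<exists>q\<in>\<A>. e q \<in> G \<and> p \<subseteq> q" if "finite p" "p \<subseteq> S'" for p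
    using that
  proof (induction p)
    case empty
    obtain x where "x \<in> G" using G(1) unfolding filter_on_def by blast
    then show ?case using G(1) Field unfolding filter_on_def by auto
  next
    case (insert s p)
    obtain q where q: "q \<in> \<A>" "e q \<in> G" "p \<subseteq> q" using insert by auto
    obtain q' where q': "q' \<in> \<A>" "e q' \<in> G" "s \<in> q'" using insert.prems unfolding S'_def by auto
    obtain x where x: "x \<in> G" "(x, e q) \<in> P" "(x, e q') \<in> P"
      using G(1) q(2) q'(2) unfolding filter_on_def by blast
    have "x \<in> e ` \<A>" using x(1) G(1) Field unfolding filter_on_def by blast
    then obtain q'' where q'': "q'' \<in> \<A>" "x = e q''" by blast
    have "insert s p \<subseteq> q''"
      using P_iff[OF q(1) q''(1)] P_iff[OF q'(1) q''(1)] x(2,3) q''(2) q(3) q'(3) by auto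
    then show ?case using x(1) q'' by blast
  qed
  show ?thesis
  proof (rule that)
    show "S' \<subseteq> S" unfolding S'_def \<A>_def cond_def by auto
    show "uncountable S'"
    proof (rule unbounded_omega1_uncountable)
      fix \<beta>
      obtain q s where "q \<in> \<A>" "e q \<in> G" "s \<in> q" "\<beta> < s"
        using G(2)[of \<beta>] unfolding dense_def by auto
      then show "\<exists>s\<in>S'. \<beta> < s" unfolding S'_def by auto
    qed
    fix p assume "finite p" "p \<subseteq> S'"
    then obtain q where "q \<in> \<A>" "p \<subseteq> q" using sub by blast
    then show "C (pi_set \<tau> \<F> n p)"
      using C_mono pi_set_mono unfolding \<A>_def cond_def by blast
  qed
qed

section \<open>The ultrafilter\<close>

lemma captured_family_cong:
  assumes "captured_family \<tau> \<F> l n D" and eq: "\<And>i. i < n \<Longrightarrow> D' i = D i"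
  shows "captured_family \<tau> \<F> l n D'"
proof -
  obtain d R where *: "\<forall>i<n. finite (D i) \<and> card (D i) = d" "root_tail_tail n D R"
    "\<forall>i<n. \<forall>a<d. Xi \<tau> \<F> (elt (D i) a) l = (if a < card R then -1 else int i)"
    "\<forall>j<n. \<forall>i<j. \<forall>a. card R \<le> a \<and> a < d \<longrightarrow>
      rho \<tau> \<F> (elt (D i) a) (elt (D j) a) = l \<and> Delta \<tau> \<F> (elt (D i) a) (elt (D j) a) = l"
    using assms(1) unfolding captured_family_def by blast
  show ?thesis
    unfolding captured_family_def
  proof (intro exI[of _ d] exI[of _ R] conjI)
    show "root_tail_tail n D' R"
      using *(2) eq unfolding root_tail_tail_def by simp
  qed (use * eq in simp_all)
qed

lemma pi_set_finite_support:
  "l \<in> pi_set \<tau> \<F> n S \<Longrightarrow> \<exists>p\<subseteq>S. finite p \<and> l \<in> pi_set \<tau> \<F> n p"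
  unfolding pi_set_def by blast

lemma mem_U_family_iff:
  "A \<in> U_family \<tau> \<F> n \<longleftrightarrow> (\<exists>S. uncountable S \<and> pi_set \<tau> \<F> n S \<subseteq> A)"
  unfolding U_family_def by (simp add: uncountable_omega1_set_iff)

context scheme
begin

lemma captured_singletons_mem_pi_set:
  assumes n: "2 \<le> n" and D: "inj_on D {..<n}" "D ` {..<n} \<subseteq> (\<lambda>s. {s}) ` S"
    and cap: "captured_family \<tau> \<F> l n D"
  shows "l \<in> pi_set \<tau> \<F> n S"
proof -
  define t where "t i = the_elem (D i)" for i
  have t: "{t i} = D i" "t i \<in> S" if "i < n" for i
    using D(2) that unfolding t_def by auto
  have "inj_on t {..<n}"
  proof (rule inj_onI)
    fix i j assume ij: "i \<in> {..<n}" "j \<in> {..<n}" "t i = t j"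
    then have "D i = D j" using t(1)[of i] t(1)[of j] by simp
    then show "i = j" using inj_onD[OF D(1)] ij(1,2) by blast
  qed
  moreover have "captured_family \<tau> \<F> l n (\<lambda>i. {t i})"
    using cap t(1) by (rule captured_family_cong)
  ultimately have "captured_tuple l n t"
    using captured_family_singletons[OF n] by blast
  then show ?thesis
    unfolding mem_pi_set_iff[OF n] using t(2) by auto
qed

lemma infinite_pi_set:
  assumes n: "2 \<le> n" and cap: "n_capturing \<tau> \<F> n" and S: "uncountable S"
  shows "infinite (pi_set \<tau> \<F> n S)"
proof -
  let ?X = "(\<lambda>s. {s}) ` S"
  let ?L = "{l. \<exists>D. inj_on D {..<n} \<and> D ` {..<n} \<subseteq> ?X \<and> captured_family \<tau> \<F> l n D}"
  have "uncountable ?X"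
    using S countable_image_inj_on[of "\<lambda>s. {s}" S] by (auto simp: inj_on_def)
  then have "(\<forall>D\<in>?X. finite D) \<and> uncountable ?X" by simp
  then have "infinite ?L"
    by (rule cap[unfolded n_capturing_def, THEN spec, THEN mp])
  moreover have "?L \<subseteq> pi_set \<tau> \<F> n S"
    using captured_singletons_mem_pi_set[OF n] by blast
  ultimately show ?thesis using finite_subset by blast
qed

text \<open>\<open>uncountable_family_refine\<close>, applied to the singletons of \<open>S\<close>
  with ordinals taken from \<open>T\<close>, yields an uncountable subset of \<open>T\<close> whose
  captured levels are all captured in \<open>S\<close>.\<close>

lemma pi_sets_meet:
  assumes n: "2 \<le> n" and cap: "n_capturing \<tau> \<F> n" and S: "uncountable S" and T: "uncountable T"
  shows "\<exists>l. l \<in> pi_set \<tau> \<F> n S \<and> l \<in> pi_set \<tau> \<F> n T"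
proof -
  let ?X = "(\<lambda>s. {s}) ` S"
  have X: "uncountable ?X"
    using S countable_image_inj_on[of "\<lambda>s. {s}" S] by (auto simp: inj_on_def)
  obtain T' where T': "T' \<subseteq> T" "uncountable T'"
    and cap': "\<And>l. l \<in> pi_set \<tau> \<F> n T' \<Longrightarrow>
      \<exists>D. inj_on D {..<n} \<and> D ` {..<n} \<subseteq> ?X \<and> captured_family \<tau> \<F> l n D"
  proof (rule uncountable_family_refine[OF n T X, where p = "\<lambda>_. {}" and N = 0])
    fix T' Q
    assume T': "T' \<subseteq> T" "uncountable T'"
      and *: "\<And>l. l \<in> pi_set \<tau> \<F> n T' \<Longrightarrow> 0 < l \<and> (\<exists>D. inj_on D {..<n} \<and> D ` {..<n} \<subseteq> ?X \<and>
        captured_family \<tau> \<F> l n D \<and> (\<forall>i<n. pi_set \<tau> \<F> n {} = Q) \<and>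
        pi_set \<tau> \<F> n (\<Union>i<n. {}) \<subseteq> insert l Q)"
    show thesis
    proof (rule that[OF T'])
      fix l assume "l \<in> pi_set \<tau> \<F> n T'"
      from *[OF this] show "\<exists>D. inj_on D {..<n} \<and> D ` {..<n} \<subseteq> ?X \<and> captured_family \<tau> \<F> l n D"
        by (elim conjE exE) (intro exI conjI)
    qed
  qed auto
  obtain l where l: "l \<in> pi_set \<tau> \<F> n T'"
    using infinite_pi_set[OF n cap T'(2)] infinite_imp_nonempty by blast
  then have "l \<in> pi_set \<tau> \<F> n S"
    using cap' captured_singletons_mem_pi_set[OF n] by blast
  moreover have "l \<in> pi_set \<tau> \<F> n T" using l pi_set_mono[OF T'(1)] by blast
  ultimately show ?thesis by blast
qed

end

theorem mainTheorem16:
  fixes \<tau> :: scheme_type and \<F> :: "omega1 set set" and n :: nat and \<kappa> :: "'p set rel"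
  assumes "2 \<le> n"
    and "good_type \<tau>"
    and "construction_scheme \<tau> \<F>"
    and "n_capturing \<tau> \<F> n"
    and "|UNIV :: nat set set| \<le>o |UNIV :: 'p set|"
    and "is_m_capturing \<tau> \<F> n \<kappa>"
    and "cardSuc natLeq <o \<kappa>"
  shows "Ramsey_ultrafilter (U_family \<tau> \<F> n)"
proof -
  interpret scheme \<tau> \<F> by standard fact+
  let ?U = "U_family \<tau> \<F> n" and ?pi = "pi_set \<tau> \<F> n"
  note generic = generic_uncountable_set[OF assms(1,5-7)]
  note meet = pi_sets_meet[OF assms(1,4)]
  \<comment> \<open>The generic set for \<open>C Q\<close> being \<open>Q \<subseteq> A\<close>: a
    set \<open>A\<close> that meets \<open>?pi T\<close> for every uncountable
    \<open>T \<subseteq> S\<close> contains some \<open>?pi S'\<close>.\<close>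
  have thin: "\<exists>S'\<subseteq>S. uncountable S' \<and> ?pi S' \<subseteq> A"
    if S: "uncountable S" and A: "\<And>T. T \<subseteq> S \<Longrightarrow> uncountable T \<Longrightarrow> \<exists>l\<in>?pi T. l \<in> A" for S A
  proof -
    have extend: "\<exists>l\<in>?pi T. insert l Q \<subseteq> A"
      if "finite Q" "Q \<subseteq> A" "T \<subseteq> S" "uncountable T" for Q T
      using A[OF that(3,4)] that(2) by blast
    obtain S' where S': "S' \<subseteq> S" "uncountable S'"
      "\<And>p. finite p \<Longrightarrow> p \<subseteq> S' \<Longrightarrow> ?pi p \<subseteq> A"
    proof (rule generic[OF S, where C = "\<lambda>Q. Q \<subseteq> A"])
      fix S' assume "S' \<subseteq> S" "uncountable S'"
        "\<And>p. finite p \<Longrightarrow> p \<subseteq> S' \<Longrightarrow> ?pi p \<subseteq> A"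
      then show thesis by (rule that)
    qed (blast, blast, rule extend)
    have "?pi S' \<subseteq> A"
    proof
      fix l assume "l \<in> ?pi S'"
      then obtain p where "p \<subseteq> S'" "finite p" "l \<in> ?pi p" using pi_set_finite_support by metis
      then show "l \<in> A" using S'(3) by blast
    qed
    then show ?thesis using S'(1,2) by blast
  qed
  have up: "B \<in> ?U" if "A \<in> ?U" "A \<subseteq> B" for A B
    using that unfolding mem_U_family_iff by (meson subset_trans)
  have inter: "A \<inter> B \<in> ?U" if A: "A \<in> ?U" and B: "B \<in> ?U" for A B
  proof -
    obtain S T where S: "uncountable S" "?pi S \<subseteq> A" and T: "uncountable T" "?pi T \<subseteq> B"
      using A B unfolding mem_U_family_iff by auto
    \<comment> \<open>Since \<open>B\<close> contains \<open>?pi T\<close>, the meeting of any two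
      such sets supplies the hypothesis of \<open>thin\<close>.\<close>
    have "\<exists>l\<in>?pi S'. l \<in> B" if "uncountable S'" for S'
      using meet[OF that T(1)] T(2) by blast
    then obtain S' where S': "S' \<subseteq> S" "uncountable S'" "?pi S' \<subseteq> B"
      using thin[OF S(1), of B] by auto
    have "?pi S' \<subseteq> A \<inter> B" using pi_set_mono[OF S'(1), of n] S(2) S'(3) by blast
    then show ?thesis using S'(2) unfolding mem_U_family_iff by blast
  qed
  have inf: "infinite A" if A: "A \<in> ?U" for A
  proof -
    obtain S where "uncountable S" "?pi S \<subseteq> A" using A unfolding mem_U_family_iff by blast
    then show ?thesis using infinite_pi_set[OF assms(1,4)] infinite_super by metis
  qed
  have ultra: "A \<in> ?U \<or> - A \<in> ?U" for A
  proof (cases "\<forall>T. uncountable T \<longrightarrow> (\<exists>l\<in>?pi T. l \<in> A)")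
    case True
    then obtain S where "uncountable S" "?pi S \<subseteq> A"
      using thin[OF uncountable_omega1, of A] by auto
    then show ?thesis unfolding mem_U_family_iff by blast
  next
    case False
    then obtain T where "uncountable T" "?pi T \<subseteq> - A" by auto
    then show ?thesis unfolding mem_U_family_iff by blast
  qed
  have UNIV: "UNIV \<in> ?U" using uncountable_omega1 unfolding mem_U_family_iff by auto
  have "ultrafilter ?U"
    unfolding ultrafilter_def
  proof (intro conjI allI ballI impI)
    show "{} \<notin> ?U" using inf[of "{}"] by auto
    show "{x} \<notin> ?U" for x using inf[of "{x}"] by auto
  qed (use UNIV up inter ultra in auto)
  moreover have "\<exists>A\<in>?U. \<forall>X\<in>\<P>. \<forall>x\<in>A \<inter> X. \<forall>y\<in>A \<inter> X. x = y"
    if part: "partition_on UNIV \<P>" and small: "\<forall>X\<in>\<P>. X \<notin> ?U" for \<P>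
  proof -
    define selector where "selector Q \<longleftrightarrow> (\<forall>X\<in>\<P>. \<forall>x\<in>Q \<inter> X. \<forall>y\<in>Q \<inter> X. x = y)" for Q
    have extend: "\<exists>l\<in>?pi T. selector (insert l Q)"
      if Q: "finite Q" "selector Q" and T: "uncountable T" for Q T
    proof -
      \<comment> \<open>Only finitely many pieces meet \<open>Q\<close>, and their complements are
        in the ultrafilter. So \<open>?pi T\<close> meets \<open>W\<close>, and a level found there
        lies in none of those pieces.\<close>
      define W where "W = (\<Inter>X\<in>{X \<in> \<P>. X \<inter> Q \<noteq> {}}. - X)"
      have "{X \<in> \<P>. X \<inter> Q \<noteq> {}} \<subseteq> (\<lambda>x. THE X. X \<in> \<P> \<and> x \<in> X) ` Q"
      proof
        fix X assume "X \<in> {X \<in> \<P>. X \<inter> Q \<noteq> {}}"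
        then obtain x where x: "X \<in> \<P>" "x \<in> X" "x \<in> Q" by blast
        have "(THE X. X \<in> \<P> \<and> x \<in> X) = X"
          using partition_onD2[OF part] x unfolding disjoint_def by (intro the_equality) auto
        then show "X \<in> (\<lambda>x. THE X. X \<in> \<P> \<and> x \<in> X) ` Q" using x(3) by blast
      qed
      then have "finite {X \<in> \<P>. X \<inter> Q \<noteq> {}}" using Q(1) finite_surj by blast
      moreover have "(\<Inter>X\<in>\<Y>. - X) \<in> ?U" if "finite \<Y>" "\<Y> \<subseteq> \<P>" for \<Y>
        using that
      proof (induction \<Y>)
        case empty
        then show ?case using UNIV by simp
      next
        case (insert X \<Y>)
        then have "- X \<in> ?U" using ultra[of X] small by blast
        then show ?case using inter insert by simp
      qed
      ultimately have "W \<in> ?U" unfolding W_def by blast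
      then obtain S where "uncountable S" "?pi S \<subseteq> W" unfolding mem_U_family_iff by blast
      then obtain l where l: "l \<in> ?pi T" "l \<in> W" using meet[OF T, of S] by blast
      have "selector (insert l Q)"
        using Q(2) l(2) unfolding selector_def W_def by auto
      then show ?thesis using l(1) by blast
    qed
    have empty: "selector {}" and mono: "\<And>Q Q'. selector Q \<Longrightarrow> Q' \<subseteq> Q \<Longrightarrow> selector Q'"
      unfolding selector_def by blast+
    obtain S where S: "uncountable S" "\<And>p. finite p \<Longrightarrow> p \<subseteq> S \<Longrightarrow> selector (?pi p)"
    proof (rule generic[OF uncountable_omega1, where C = selector])
      fix S' assume "uncountable S'" "\<And>p. finite p \<Longrightarrow> p \<subseteq> S' \<Longrightarrow> selector (?pi p)"
      then show thesis by (rule that)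
    qed (rule empty, erule (1) mono, erule (2) extend)
    \<comment> \<open>Being a selector concerns two points at a time, so the union of two finite
      supports suffices.\<close>
    have "selector (?pi S)"
      unfolding selector_def
    proof (intro ballI)
      fix X x y assume X: "X \<in> \<P>" and x: "x \<in> ?pi S \<inter> X" and y: "y \<in> ?pi S \<inter> X"
      obtain p where p: "p \<subseteq> S" "finite p" "x \<in> ?pi p"
        using pi_set_finite_support x by (metis IntD1)
      obtain q where q: "q \<subseteq> S" "finite q" "y \<in> ?pi q"
        using pi_set_finite_support y by (metis IntD1)
      have "x \<in> ?pi (p \<union> q)" "y \<in> ?pi (p \<union> q)"
        using p(3) q(3) pi_set_mono[of p "p \<union> q" n] pi_set_mono[of q "p \<union> q" n] by auto
      moreover have "selector (?pi (p \<union> q))" using S(2)[of "p \<union> q"] p q by simp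
      ultimately show "x = y" using X x y unfolding selector_def by auto
    qed
    moreover have "?pi S \<in> ?U" using S(1) unfolding mem_U_family_iff by blast
    ultimately show ?thesis unfolding selector_def by blast
  qed
  ultimately show ?thesis
    unfolding Ramsey_ultrafilter_def by blast
qed

end
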